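(* Let $P \subset \mathbb{R}^d$ be a $d$-dimensional simple rational polytope with vertex set $V$, and let $m$ be a positive integer. (a) For almost all $z \in \mathbb{C}^d$ and all real $t>0$, $$\sum_{p \in tP \cap \mathbb{Z}^d} \langle p, z\rangle^m = (-1)^d m! \sum_{v\in V} \sum_{k=0}^{d+m} \frac{1}{k!\,(d+m-k)!} B_k\big(t\langle v,z\rangle, \mathbf{a}_v\big) \sum_{q \in (\mathbb{Z}^d - tv)\cap\Pi_v} \langle q, z\rangle^{d+m-k}.$$ (b) Writing the quasi-polynomial of part (a) as $\sum_{p \in tP\cap\mathbb{Z}^d}\langle p,z\rangle^m = \sum_{r=0}^{d+m} d_r(t)\,t^r$, for almost all $z\in\mathbb{C}^d$ and all $t>0$, $$d_r(t) = \frac{(-1)^d m!}{(d+m)!} \sum_{v\in V} \sum_{j=0}^{d+m-r} \binom{d+m}{r,j} B_j(\mathbf{a}_v) \langle v,z\rangle^r \sum_{q\in(\mathbb{Z}^d - tv)\cap\Pi_v} \langle q,z\rangle^{d+m-r-j}.$$ (c) The coefficients $d_r(t)$ of part (b) satisfy $\frac{d}{dt} d_r(t) = -(r+1)\, d_{r+1}(t)$.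
   Context: A polytope is simple if each vertex lies on exactly $d$ edges. For each vertex $v$ of $P$, let $w_1(v),\dots,w_d(v)$ be the primitive integer vectors (gcd of coordinates equal to $1$) pointing along the $d$ edges emanating from $v$, and $\Pi_v := \{\sum_{k=1}^d \lambda_k w_k(v) : 0 \le \lambda_k < 1\}$. For $z \in \mathbb{C}^d$, $\langle x, z\rangle := \sum_{m} x_m z_m$ (no conjugation). Set $\mathbf{a}_v := (\langle w_1(v), z\rangle, \dots, \langle w_d(v), z\rangle)$. For $\mathbf{a}\in\mathbb{C}^d$ with all $a_j\neq 0$, Barnes polynomials are defined by $\frac{x^d e^{tx}}{\prod_{j=1}^d(e^{a_jx}-1)} = \sum_{k\ge0} B_k(t,\mathbf{a})\frac{x^k}{k!}$ near $x=0$, and Barnes numbers by $B_k(\mathbf{a}) := B_k(0,\mathbf{a})$. The sum over $q\in(\mathbb{Z}^d - tv)\cap\Pi_v$ runs over points of the translated lattice $\mathbb{Z}^d - tv$ lying in $\Pi_v$; $\langle q,z\rangle^0=1$. $\binom{n}{r,j} := \frac{n!}{r!\,j!\,(n-r-j)!}$. "For almost all $z$" means for all $z$ with $\langle z, w_k(v)\rangle \notin 2\pi i\mathbb{Z}$ for every vertex $v$ and every $k$.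
   Formalization: Part (c) fails where coefficients jump (P=[0,1], m=1, z=1: d_1(t)=1/2-{t} at integers), so it is proved at every t>0 where d_r and d_{r+1} are continuous; it is also shown that only finitely many t in each (0,b] are discontinuities. *)

theory Defs
  imports "HOL-Analysis.Analysis"
begin

definition vertices :: "'a::real_vector set \<Rightarrow> 'a set"
  where "vertices P = {v. v extreme_point_of P}"

definition int_lattice :: "(real^'n) set"
  where "int_lattice = {x. \<forall>i. x $ i \<in> \<int>}"

definition rational_polytope :: "(real^'n) set \<Rightarrow> bool"
  where "rational_polytope P \<longleftrightarrow> polytope P \<and> (\<forall>v\<in>vertices P. \<forall>i. v $ i \<in> \<rat>)"

definition simple_polytope :: "(real^'n) set \<Rightarrow> bool"
  where "simple_polytope P \<longleftrightarrow>
    polytope P \<and> (\<forall>v\<in>vertices P. card {F. F edge_of P \<and> v \<in> F} = CARD('n))"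

definition primitive_vec :: "real^'n \<Rightarrow> bool"
  where "primitive_vec x \<longleftrightarrow>
    (\<exists>u :: int^'n. x = (\<chi> i. of_int (u $ i)) \<and> Gcd (range (\<lambda>i. u $ i)) = 1)"

definition edge_directions :: "(real^'n) set \<Rightarrow> real^'n \<Rightarrow> (real^'n) set"
  where "edge_directions P v =
    {x. primitive_vec x \<and> (\<exists>F. F edge_of P \<and> v \<in> F \<and> (\<exists>s>0. v + s *\<^sub>R x \<in> F))}"

text \<open>The index type of the coordinates, which has exactly \<open>d\<close> elements, also serves to number
  the \<open>d\<close> edges at a vertex; the numbering is arbitrary.\<close>

definition edge_numbering :: "(real^'n) set \<Rightarrow> (real^'n \<Rightarrow> 'n \<Rightarrow> real^'n) \<Rightarrow> bool"
  where "edge_numbering P w \<longleftrightarrow>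
    (\<forall>v\<in>vertices P. bij_betw (w v) UNIV (edge_directions P v))"

definition half_open_box :: "('n \<Rightarrow> real^'n) \<Rightarrow> (real^'n) set"
  where "half_open_box u = {x. \<exists>l. (\<forall>k. 0 \<le> l k \<and> l k < 1) \<and> x = (\<Sum>k\<in>UNIV. l k *\<^sub>R u k)}"

text \<open>The bilinear pairing, without conjugation.\<close>

definition pairing :: "real^'n \<Rightarrow> complex^'n \<Rightarrow> complex"
  where "pairing x z = (\<Sum>i\<in>UNIV. of_real (x $ i) * z $ i)"

definition edge_values :: "('n \<Rightarrow> real^'n) \<Rightarrow> complex^'n \<Rightarrow> complex^'n"
  where "edge_values u z = (\<chi> k. pairing (u k) z)"

text \<open>The lattice points translated by \<open>- t v\<close> that lie in the half-open parallelepiped at \<open>v\<close>.\<close>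

definition box_points :: "('n \<Rightarrow> real^'n) \<Rightarrow> real \<Rightarrow> real^'n \<Rightarrow> (real^'n) set"
  where "box_points u t v = (\<lambda>p. p - t *\<^sub>R v) ` int_lattice \<inter> half_open_box u"

definition generic :: "(real^'n) set \<Rightarrow> (real^'n \<Rightarrow> 'n \<Rightarrow> real^'n) \<Rightarrow> complex^'n \<Rightarrow> bool"
  where "generic P w z \<longleftrightarrow>
    (\<forall>v\<in>vertices P. \<forall>k. \<forall>n::int. pairing (w v k) z \<noteq> 2 * of_real pi * \<i> * of_int n)"

definition power_sum :: "(real^'n) set \<Rightarrow> nat \<Rightarrow> complex^'n \<Rightarrow> real \<Rightarrow> complex"
  where "power_sum P m z t = (\<Sum>p\<in>(\<lambda>x. t *\<^sub>R x) ` P \<inter> int_lattice. pairing p z ^ m)"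

text \<open>Meaningful only if all entries of \<open>a\<close> are nonzero: then both sides of the quotient of power
  series have subdegree \<open>d\<close>, and the quotient is the Taylor expansion, as
  \<open>barnes_generating_function\<close> below confirms.\<close>

definition barnes_poly :: "nat \<Rightarrow> complex \<Rightarrow> complex^'n \<Rightarrow> complex"
  where "barnes_poly k t a =
    fact k * fps_nth (fps_X ^ CARD('n) * fps_exp t / (\<Prod>j\<in>UNIV. fps_exp (a $ j) - 1)) k"

definition barnes_number :: "nat \<Rightarrow> complex^'n \<Rightarrow> complex"
  where "barnes_number k a = barnes_poly k 0 a"

lemma barnes_generating_function:
  fixes a :: "complex^'n"
  assumes "\<And>j. a $ j \<noteq> 0"
  shows "\<forall>\<^sub>F x in at 0. (\<lambda>k. barnes_poly k t a * x ^ k / fact k) sums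
           (x ^ CARD('n) * exp (t * x) / (\<Prod>j\<in>UNIV. exp (a $ j * x) - 1))"
proof -
  define G where "G = (\<Prod>j\<in>(UNIV::'n set). fps_exp (a $ j) - 1)"
  define F where "F = fps_X ^ CARD('n) * fps_exp t"
  have nz: "fps_exp (a $ j) - 1 \<noteq> 0" and sd: "subdegree (fps_exp (a $ j) - 1) = 1" for j
  proof -
    have 1: "fps_nth (fps_exp (a $ j) - 1) 1 \<noteq> 0" using assms[of j] by simp
    then show "fps_exp (a $ j) - 1 \<noteq> 0" by force
    show "subdegree (fps_exp (a $ j) - 1) = 1"
      using 1 by (intro subdegreeI) auto
  qed
  have G0: "G \<noteq> 0" unfolding G_def using nz by simp
  have sG: "subdegree G = CARD('n)"
    unfolding G_def using nz sd by (subst subdegree_prod) auto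
  have sF: "subdegree F = CARD('n)"
    unfolding F_def by (subst subdegree_mult) auto
  have "(\<lambda>x. x ^ CARD('n) * exp (t * x)) has_fps_expansion F"
    unfolding F_def by (intro fps_expansion_intros)
  moreover have "(\<lambda>x. \<Prod>j\<in>UNIV. exp (a $ j * x) - 1) has_fps_expansion G"
    unfolding G_def by (intro fps_expansion_intros)
  ultimately have "(\<lambda>x. if x = 0 then fps_nth F (subdegree G) / fps_nth G (subdegree G)
      else x ^ CARD('n) * exp (t * x) / (\<Prod>j\<in>UNIV. exp (a $ j * x) - 1)) has_fps_expansion (F / G)"
    by (rule has_fps_expansion_divide) (use sG sF G0 in auto)
  then have rad: "fps_conv_radius (F / G) > 0"
    and ev: "\<forall>\<^sub>F x in nhds 0. eval_fps (F / G) x =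
      (if x = 0 then fps_nth F (subdegree G) / fps_nth G (subdegree G)
      else x ^ CARD('n) * exp (t * x) / (\<Prod>j\<in>UNIV. exp (a $ j * x) - 1))"
    by (auto simp: has_fps_expansion_def)
  have "\<forall>\<^sub>F x in nhds 0. x \<in> eball (0::complex) (fps_conv_radius (F / G))"
    using rad by (intro eventually_nhds_in_open) (auto simp: zero_ereal_def)
  then have "\<forall>\<^sub>F x in at 0. x \<in> eball (0::complex) (fps_conv_radius (F / G))"
    by (auto simp: eventually_at_filter elim: eventually_mono)
  moreover have "\<forall>\<^sub>F x in at 0. eval_fps (F / G) x =
      x ^ CARD('n) * exp (t * x) / (\<Prod>j\<in>UNIV. exp (a $ j * x) - 1)"
    using ev by (auto simp: eventually_at_filter elim: eventually_mono)
  ultimately show ?thesis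
  proof eventually_elim
    case (elim x)
    have "(\<lambda>k. fps_nth (F / G) k * x ^ k) sums eval_fps (F / G) x"
      using elim(1) by (intro sums_eval_fps) (simp add: in_eball_iff)
    then show ?case
      using elim(2) by (simp add: barnes_poly_def F_def G_def)
  qed
qed

definition trinomial :: "nat \<Rightarrow> nat \<Rightarrow> nat \<Rightarrow> complex"
  where "trinomial n r j = fact n / (fact r * fact j * fact (n - r - j))"

text \<open>\<open>c\<close> is a family of coefficient functions exhibiting \<open>f\<close> as a quasi-polynomial of degree at
  most \<open>n\<close> in the positive real variable \<open>t\<close>.  The common period makes the coefficients unique.
  Coefficients beyond the degree are zero by convention.\<close>

definition quasi_poly_coeffs :: "nat \<Rightarrow> (real \<Rightarrow> complex) \<Rightarrow> (nat \<Rightarrow> real \<Rightarrow> complex) \<Rightarrow> bool"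
  where "quasi_poly_coeffs n f c \<longleftrightarrow>
    (\<exists>T>0. \<forall>r\<le>n. \<forall>t>0. c r (t + T) = c r t) \<and>
    (\<forall>r>n. \<forall>t>0. c r t = 0) \<and>
    (\<forall>t>0. f t = (\<Sum>r\<le>n. c r t * of_real t ^ r))"

end

theory Submission
  imports Defs
begin

text \<open>
  Part (a) is Brion's formula, proved for one fixed \<open>z\<close> with formal power series only.  Summing
  \<open>exp (x * pairing p z)\<close> over the lattice extends from finitely supported functions to all
  functions that some product of differences \<open>f p - f (p - w)\<close> with \<open>pairing w z \<noteq> 0\<close> makes finitely
  supported; the extension is linear, vanishes on functions with such a period \<open>w\<close>, and sends the
  cone at a vertex to its box sum divided by \<open>\<Prod>(1 - exp (x * pairing w\<^sub>k z))\<close>.  It remains to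
  write the indicator of a dilated polytope as the sum of the indicators of its vertex cones plus
  terms that are periodic along an edge.  For vertices \<open>V\<close>, let \<open>K F\<close> consist of the affine
  combinations of \<open>V\<close> whose coefficients outside \<open>F \<subseteq> V\<close> are nonnegative.  Then \<open>K {}\<close> is the
  polytope, \<open>K {v}\<close> the cone at \<open>v\<close>, larger \<open>F\<close> give sets that contain lines, and the
  alternating sum of all these indicators vanishes.

  For (b) and (c), the power sum is a step function of \<open>t\<close>.  Lagrange interpolation at
  \<open>t, t + T, t + 2 T, \<dots>\<close> recovers quasi-polynomial coefficients of period \<open>T\<close> from it: near \<open>t\<close> they
  are the coefficients of \<open>Q (s - t)\<close> in \<open>s\<close> for a polynomial \<open>Q\<close> that is locally constant in \<open>t\<close>.
  This gives the differential equation and the boundedness on which uniqueness rests.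
\<close>

section \<open>An alternating sum over generalized cones\<close>

text \<open>The coefficients with index in \<open>F\<close> may have any sign.\<close>

definition gcone :: "('i \<Rightarrow> 'b::real_vector) \<Rightarrow> 'i set \<Rightarrow> 'i set \<Rightarrow> 'b set"
  where "gcone a I F = {\<Sum>i\<in>I. \<mu> i *\<^sub>R a i | \<mu>. \<forall>i\<in>I - F. 0 \<le> \<mu> i}"

lemma gcone_add: "x \<in> gcone a I F \<Longrightarrow> y \<in> gcone a I F \<Longrightarrow> x + y \<in> gcone a I F"
proof -
  assume "x \<in> gcone a I F" "y \<in> gcone a I F"
  then obtain \<mu> \<nu> where "x = (\<Sum>i\<in>I. \<mu> i *\<^sub>R a i)" "\<forall>i\<in>I - F. 0 \<le> \<mu> i"
    "y = (\<Sum>i\<in>I. \<nu> i *\<^sub>R a i)" "\<forall>i\<in>I - F. 0 \<le> \<nu> i"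
    by (auto simp: gcone_def)
  then show ?thesis
    unfolding gcone_def
    by (intro CollectI exI[of _ "\<lambda>i. \<mu> i + \<nu> i"]) (auto simp: scaleR_add_left sum.distrib)
qed

lemma gcone_scale: "x \<in> gcone a I F \<Longrightarrow> 0 \<le> c \<Longrightarrow> c *\<^sub>R x \<in> gcone a I F"
proof -
  assume "x \<in> gcone a I F" "0 \<le> c"
  then obtain \<mu> where "x = (\<Sum>i\<in>I. \<mu> i *\<^sub>R a i)" "\<forall>i\<in>I - F. 0 \<le> \<mu> i"
    by (auto simp: gcone_def)
  then show ?thesis
    unfolding gcone_def using \<open>0 \<le> c\<close>
    by (intro CollectI exI[of _ "\<lambda>i. c * \<mu> i"]) (auto simp: scaleR_sum_right)
qed

lemma gcone_zero: "0 \<in> gcone a I F"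
  unfolding gcone_def by (intro CollectI exI[of _ "\<lambda>i. 0"]) auto

lemma gcone_generator: "finite I \<Longrightarrow> i \<in> I \<Longrightarrow> 0 \<le> s \<or> i \<in> F \<Longrightarrow> s *\<^sub>R a i \<in> gcone a I F"
  unfolding gcone_def
  by (intro CollectI exI[of _ "\<lambda>j. if j = i then s else 0"])
    (auto simp: if_distrib[of "\<lambda>c. c *\<^sub>R _"] cong: if_cong)

lemma gcone_sum: "(\<And>j. j \<in> J \<Longrightarrow> g j \<in> gcone a I F) \<Longrightarrow> (\<Sum>j\<in>J. g j) \<in> gcone a I F"
  by (induction J rule: infinite_finite_induct) (auto simp: gcone_zero intro: gcone_add)

text \<open>This is the convex cone spanned by the finitely many vectors \<open>a i\<close>
  (\<open>i\<close> in \<open>I\<close>) and \<open>- a i\<close> (\<open>i\<close> in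
  \<open>F\<close>), and finitely generated cones are closed. Closedness makes the maxima of line
  sections exist.\<close>

lemma closed_gcone:
  fixes a :: "'i \<Rightarrow> 'b::euclidean_space"
  assumes "finite I" "F \<subseteq> I"
  shows "closed (gcone a I F)"
proof -
  let ?H = "convex_cone hull (a ` I \<union> (\<lambda>i. - a i) ` F)"
  have "gcone a I F \<subseteq> ?H"
  proof
    fix x assume "x \<in> gcone a I F"
    then obtain \<mu> where \<mu>: "x = (\<Sum>i\<in>I. \<mu> i *\<^sub>R a i)" "\<forall>i\<in>I - F. 0 \<le> \<mu> i"
      by (auto simp: gcone_def)
    have *: "\<mu> i *\<^sub>R a i \<in> ?H" if "i \<in> I" for i
    proof (cases "0 \<le> \<mu> i")
      case True
      then show ?thesis using that by (intro convex_cone_hull_mul hull_inc) auto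
    next
      case False
      then have "(- \<mu> i) *\<^sub>R (- a i) \<in> ?H" using that \<mu> by (intro convex_cone_hull_mul hull_inc) auto
      then show ?thesis by simp
    qed
    have "(\<Sum>i\<in>J. \<mu> i *\<^sub>R a i) \<in> ?H" if "finite J" "J \<subseteq> I" for J
      using that by (induction J) (auto simp: convex_cone_hull_contains_0 intro!: convex_cone_hull_add *)
    then show "x \<in> ?H" using \<mu> assms by auto
  qed
  moreover have "?H \<subseteq> gcone a I F"
  proof (rule hull_minimal)
    show "a ` I \<union> (\<lambda>i. - a i) ` F \<subseteq> gcone a I F"
      using gcone_generator[OF assms(1), of _ 1 F a] gcone_generator[OF assms(1), of _ "-1" F a] assms(2)
      by auto
    show "convex_cone (gcone a I F)"
      unfolding convex_cone_iff using gcone_zero[of a I F] gcone_add[of _ a I F] gcone_scale[of _ a I F] by auto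
  qed
  ultimately have "gcone a I F = ?H" by auto
  moreover have "closed ?H" using assms finite_subset by (intro closed_convex_cone_hull) auto
  ultimately show ?thesis by simp
qed

lemma convex_gcone: "convex (gcone a I F)"
  unfolding convex_def using gcone_add gcone_scale by blast

text \<open>Drives the induction on the index set: singling out the coefficient of \<open>b\<close>
  turns membership into a question about the section of the smaller cone by a line in direction
  \<open>a b\<close>.\<close>

lemma gcone_insert:
  assumes "finite I" "b \<notin> I" "F \<subseteq> I"
  shows "y \<in> gcone a (insert b I) F \<longleftrightarrow> (\<exists>s\<ge>0. y - s *\<^sub>R a b \<in> gcone a I F)"
    and "y \<in> gcone a (insert b I) (insert b F) \<longleftrightarrow> (\<exists>s. y - s *\<^sub>R a b \<in> gcone a I F)"
proof -
  have 1: "(\<Sum>i\<in>insert b I. \<mu> i *\<^sub>R a i) - \<mu> b *\<^sub>R a b = (\<Sum>i\<in>I. \<mu> i *\<^sub>R a i)" for \<mu>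
    using assms by simp
  have 2: "(\<Sum>i\<in>insert b I. (\<mu>(b := s)) i *\<^sub>R a i) = s *\<^sub>R a b + (\<Sum>i\<in>I. \<mu> i *\<^sub>R a i)" for \<mu> s
    using assms by (auto intro!: sum.cong)
  show "y \<in> gcone a (insert b I) F \<longleftrightarrow> (\<exists>s\<ge>0. y - s *\<^sub>R a b \<in> gcone a I F)"
  proof
    assume "y \<in> gcone a (insert b I) F"
    then obtain \<mu> where "y = (\<Sum>i\<in>insert b I. \<mu> i *\<^sub>R a i)" "\<forall>i\<in>insert b I - F. 0 \<le> \<mu> i"
      by (auto simp: gcone_def)
    then show "\<exists>s\<ge>0. y - s *\<^sub>R a b \<in> gcone a I F"
      using 1[of \<mu>] assms by (intro exI[of _ "\<mu> b"]) (auto simp: gcone_def)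
  next
    assume "\<exists>s\<ge>0. y - s *\<^sub>R a b \<in> gcone a I F"
    then obtain s \<mu> where "0 \<le> s" "y - s *\<^sub>R a b = (\<Sum>i\<in>I. \<mu> i *\<^sub>R a i)" "\<forall>i\<in>I - F. 0 \<le> \<mu> i"
      by (auto simp: gcone_def)
    then show "y \<in> gcone a (insert b I) F"
      unfolding gcone_def using 2[of \<mu> s] assms
      by (intro CollectI exI[of _ "\<mu>(b := s)"]) (auto simp: algebra_simps)
  qed
  show "y \<in> gcone a (insert b I) (insert b F) \<longleftrightarrow> (\<exists>s. y - s *\<^sub>R a b \<in> gcone a I F)"
  proof
    assume "y \<in> gcone a (insert b I) (insert b F)"
    then obtain \<mu> where "y = (\<Sum>i\<in>insert b I. \<mu> i *\<^sub>R a i)" "\<forall>i\<in>insert b I - insert b F. 0 \<le> \<mu> i"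
      by (auto simp: gcone_def)
    then show "\<exists>s. y - s *\<^sub>R a b \<in> gcone a I F"
      using 1[of \<mu>] assms by (intro exI[of _ "\<mu> b"]) (auto simp: gcone_def)
  next
    assume "\<exists>s. y - s *\<^sub>R a b \<in> gcone a I F"
    then obtain s \<mu> where "y - s *\<^sub>R a b = (\<Sum>i\<in>I. \<mu> i *\<^sub>R a i)" "\<forall>i\<in>I - F. 0 \<le> \<mu> i"
      by (auto simp: gcone_def)
    then show "y \<in> gcone a (insert b I) (insert b F)"
      unfolding gcone_def using 2[of \<mu> s] assms
      by (intro CollectI exI[of _ "\<mu>(b := s)"]) (auto simp: algebra_simps)
  qed
qed

text \<open>Passing to the right of \<open>e\<close> loses exactly the intervals whose maximum is
  \<open>e\<close>: closedness prevents gaining one that misses \<open>e\<close>, and convexity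
  fills in everything between \<open>e\<close> and a larger point.\<close>

lemma eventually_right_of_closed_convex:
  fixes J :: "real set"
  assumes "closed J" "convex J"
  shows "\<forall>\<^sub>F s in at_right e. s \<in> J \<longleftrightarrow> e \<in> J \<and> \<not> (\<forall>x\<in>J. x \<le> e)"
proof (cases "e \<in> J")
  case False
  then have "\<forall>\<^sub>F s in nhds e. s \<in> - J"
    using assms by (intro eventually_nhds_in_open) auto
  then have "\<forall>\<^sub>F s in at_right e. s \<in> - J"
    by (auto simp: eventually_at_filter elim: eventually_mono)
  then show ?thesis by eventually_elim (use False in auto)
next
  case True
  show ?thesis
  proof (cases "\<forall>x\<in>J. x \<le> e")
    case True
    have "\<forall>\<^sub>F s in at_right e. s > e" by (simp add: eventually_at_filter)
    then show ?thesis by eventually_elim (use True in force)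
  next
    case False
    then obtain x where x: "x \<in> J" "e < x" by force
    have "\<forall>\<^sub>F s in at_right e. s \<in> {e<..<x}" using x(2) by (rule eventually_at_right_real)
    then show ?thesis
    proof eventually_elim
      case (elim s)
      then have "s \<in> J"
        using assms(2) x(1) \<open>e \<in> J\<close> is_interval_convex_1 mem_is_interval_1_I[of J e x s] by auto
      then show ?case using False \<open>e \<in> J\<close> by auto
    qed
  qed
qed

text \<open>The vanishing sum and its limit from the right differ at \<open>e\<close> by the contributions of the
  intervals whose maximum is \<open>e\<close>; summing over all \<open>e < 0\<close> counts the intervals left of \<open>0\<close>.\<close>

lemma sum_intervals_left_of_zero:
  fixes J :: "'f \<Rightarrow> real set" and \<epsilon> :: "'f \<Rightarrow> real"
  assumes "finite A" "\<And>F. F \<in> A \<Longrightarrow> closed (J F)" "\<And>F. F \<in> A \<Longrightarrow> convex (J F)"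
    and zero: "\<And>s. s < 0 \<Longrightarrow> (\<Sum>F\<in>A. \<epsilon> F * of_bool (s \<in> J F)) = 0"
  shows "(\<Sum>F\<in>A. \<epsilon> F * of_bool (J F \<noteq> {} \<and> J F \<subseteq> {..<0})) = 0"
proof -
  define M where "M F e \<longleftrightarrow> e \<in> J F \<and> (\<forall>x\<in>J F. x \<le> e)" for F e
  have 0: "(\<Sum>F\<in>A. \<epsilon> F * of_bool (M F e)) = 0" if "e < 0" for e
  proof -
    have "\<forall>\<^sub>F s in at_right e. \<forall>F\<in>A. s \<in> J F \<longleftrightarrow> e \<in> J F \<and> \<not> (\<forall>x\<in>J F. x \<le> e)"
      using assms by (intro eventually_ball_finite ballI eventually_right_of_closed_convex) auto
    moreover have "\<forall>\<^sub>F s in at_right e. s \<in> {e<..<0}" using that by (rule eventually_at_right_real)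
    ultimately have "\<forall>\<^sub>F s in at_right e. s < 0 \<and> (\<forall>F\<in>A. s \<in> J F \<longleftrightarrow> e \<in> J F \<and> \<not> (\<forall>x\<in>J F. x \<le> e))"
      by eventually_elim auto
    then obtain s where s: "s < 0" "\<And>F. F \<in> A \<Longrightarrow> s \<in> J F \<longleftrightarrow> e \<in> J F \<and> \<not> (\<forall>x\<in>J F. x \<le> e)"
      using eventually_happens'[OF trivial_limit_at_right_real] by blast
    have "(\<Sum>F\<in>A. \<epsilon> F * of_bool (M F e))
        = (\<Sum>F\<in>A. \<epsilon> F * of_bool (e \<in> J F)) - (\<Sum>F\<in>A. \<epsilon> F * of_bool (s \<in> J F))"
      unfolding sum_subtractf[symmetric] by (intro sum.cong) (auto simp: s M_def)
    then show ?thesis using zero s(1) that by simp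
  qed
  define E where "E = {e. e < 0 \<and> (\<exists>F\<in>A. M F e)}"
  have uniq: "M F e \<Longrightarrow> M F e' \<Longrightarrow> e = e'" for F e e'
    unfolding M_def by (meson antisym)
  have "E \<subseteq> (\<lambda>F. THE e. M F e) ` A"
  proof
    fix e assume "e \<in> E"
    then obtain F where F: "F \<in> A" "M F e" by (auto simp: E_def)
    then have "(THE e. M F e) = e" using uniq by blast
    then show "e \<in> (\<lambda>F. THE e. M F e) ` A" using F by force
  qed
  then have finE: "finite E" using assms(1) finite_subset by blast
  \<comment> \<open>A nonempty closed interval left of 0 has exactly one maximum, which lies in
    \<open>E\<close>; any other \<open>J F\<close> has no maximum in \<open>E\<close>. So the
    indicator is a count over \<open>E\<close>, and the sums can be exchanged.\<close>
  have *: "of_bool (J F \<noteq> {} \<and> J F \<subseteq> {..<0}) = (\<Sum>e\<in>E. of_bool (M F e) :: real)" if F: "F \<in> A" for F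
  proof (cases "J F \<noteq> {} \<and> J F \<subseteq> {..<0}")
    case True
    then have bd: "bdd_above (J F)" by (intro bdd_aboveI[of _ 0]) force
    define e where "e = Sup (J F)"
    have "e \<in> J F" unfolding e_def using True bd assms(2)[OF F] by (intro closed_contains_Sup) auto
    then have M: "M F e" using bd unfolding M_def e_def by (auto intro: cSup_upper)
    have "e \<in> E" using \<open>e \<in> J F\<close> True M F by (auto simp: E_def)
    have "(\<Sum>e\<in>E. of_bool (M F e) :: real) = (\<Sum>e'\<in>E. if e' = e then 1 else 0)"
    proof (intro sum.cong refl)
      fix e'
      have "M F e' \<longleftrightarrow> e' = e" using uniq M by blast
      then show "of_bool (M F e') = (if e' = e then 1 else 0 :: real)" by simp
    qed
    then show ?thesis using \<open>e \<in> E\<close> finE True by simp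
  next
    case False
    have "\<not> M F e" if "e \<in> E" for e
      using False that by (auto simp: M_def E_def) (metis lessThan_iff order_le_less_trans subsetI)
    then show ?thesis using False by simp
  qed
  have "(\<Sum>F\<in>A. \<epsilon> F * of_bool (J F \<noteq> {} \<and> J F \<subseteq> {..<0})) = (\<Sum>F\<in>A. \<Sum>e\<in>E. \<epsilon> F * of_bool (M F e))"
    by (intro sum.cong) (simp_all add: * sum_distrib_left)
  also have "\<dots> = (\<Sum>e\<in>E. \<Sum>F\<in>A. \<epsilon> F * of_bool (M F e))" by (rule sum.swap)
  also have "\<dots> = 0" using 0 by (intro sum.neutral) (auto simp: E_def)
  finally show ?thesis .
qed

lemma sum_Pow_insert:
  fixes g :: "'i set \<Rightarrow> 'c::comm_monoid_add"
  assumes "finite I" "b \<notin> I"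
  shows "(\<Sum>F\<in>Pow (insert b I). g F) = (\<Sum>F\<in>Pow I. g F + g (insert b F))"
proof -
  have "(\<Sum>F\<in>Pow (insert b I). g F) = (\<Sum>F\<in>Pow I. g F) + (\<Sum>F\<in>insert b ` Pow I. g F)"
    unfolding Pow_insert using assms by (intro sum.union_disjoint) auto
  also have "(\<Sum>F\<in>insert b ` Pow I. g F) = (\<Sum>F\<in>Pow I. g (insert b F))"
    using assms(2) by (intro sum.reindex_cong[of "insert b"]) (auto simp: inj_on_def)
  finally show ?thesis by (simp add: sum.distrib)
qed

text \<open>In the induction step for a new index \<open>b\<close>, the terms for \<open>F\<close> and \<open>insert b F\<close> differ exactly
  if the closed interval of all \<open>s\<close> with \<open>y - s *\<^sub>R a b\<close> in the smaller cone is nonempty and lies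
  left of \<open>0\<close>.\<close>

lemma alternating_sum_gcone:
  fixes a :: "'i \<Rightarrow> 'b::euclidean_space"
  assumes "finite I" and "\<And>\<mu>. (\<And>i. i \<in> I \<Longrightarrow> \<mu> i < 0) \<Longrightarrow> y \<noteq> (\<Sum>i\<in>I. \<mu> i *\<^sub>R a i)"
  shows "(\<Sum>F\<in>Pow I. (-1) ^ card F * of_bool (y \<in> gcone a I F)) = (0::real)"
  using assms
proof (induction I arbitrary: y)
  case empty
  have "y \<noteq> 0" using empty[of "\<lambda>_. 0"] by simp
  then show ?case by (simp add: gcone_def)
next
  case (insert b I)
  define J where "J F = {s. y - s *\<^sub>R a b \<in> gcone a I F}" for F
  have fin: "finite F" and bF: "b \<notin> F" if "F \<in> Pow I" for F
    using that insert.hyps finite_subset by auto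
  have J: "J F = (\<lambda>s. y - s *\<^sub>R a b) -` gcone a I F" for F by (auto simp: J_def)
  have closedJ: "closed (J F)" if "F \<in> Pow I" for F
    unfolding J using closed_gcone that insert.hyps
    by (intro continuous_closed_vimage) auto
  have convexJ: "convex (J F)" for F
  proof -
    have "(\<lambda>s. y - s *\<^sub>R a b) -` gcone a I F = (\<lambda>s. s *\<^sub>R (- a b)) -` ((\<lambda>x. -y + x) ` gcone a I F)"
      by (auto simp: algebra_simps image_iff) (metis add.commute add_diff_cancel_left' uminus_add_conv_diff)
    then show ?thesis unfolding J
      by (simp only:) (intro convex_linear_vimage convex_translation convex_gcone bounded_linear.linear bounded_linear_scaleR_left)
  qed
  \<comment> \<open>Induction hypothesis at a translated point: an all-negative combination for
    \<open>y - s *\<^sub>R a b\<close> with \<open>s < 0\<close> would extend to one for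
    \<open>y\<close>.\<close>
  have 1: "(\<Sum>F\<in>Pow I. (-1) ^ card F * of_bool (s \<in> J F)) = (0::real)" if "s < 0" for s
    unfolding J_def mem_Collect_eq
  proof (rule insert.IH)
    fix \<mu> :: "'i \<Rightarrow> real" assume \<mu>: "\<And>i. i \<in> I \<Longrightarrow> \<mu> i < 0"
    have "y \<noteq> (\<Sum>i\<in>insert b I. (\<mu>(b := s)) i *\<^sub>R a i)"
      by (rule insert.prems) (use that \<mu> in auto)
    moreover have "(\<Sum>i\<in>insert b I. (\<mu>(b := s)) i *\<^sub>R a i) = s *\<^sub>R a b + (\<Sum>i\<in>I. \<mu> i *\<^sub>R a i)"
      using insert.hyps by (auto intro!: sum.cong)
    ultimately show "y - s *\<^sub>R a b \<noteq> (\<Sum>i\<in>I. \<mu> i *\<^sub>R a i)" by (auto simp: algebra_simps)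
  qed
  have "(\<Sum>F\<in>Pow (insert b I). (-1) ^ card F * of_bool (y \<in> gcone a (insert b I) F) :: real)
      = (\<Sum>F\<in>Pow I. - ((-1) ^ card F * of_bool (J F \<noteq> {} \<and> J F \<subseteq> {..<0})))"
    unfolding sum_Pow_insert[OF insert.hyps]
  proof (intro sum.cong refl)
    fix F assume F: "F \<in> Pow I"
    have "y \<in> gcone a (insert b I) F \<longleftrightarrow> (\<exists>s\<ge>0. s \<in> J F)"
      "y \<in> gcone a (insert b I) (insert b F) \<longleftrightarrow> J F \<noteq> {}"
      using F insert.hyps by (auto simp: gcone_insert J_def)
    then show "(-1) ^ card F * of_bool (y \<in> gcone a (insert b I) F) +
      (-1) ^ card (insert b F) * of_bool (y \<in> gcone a (insert b I) (insert b F)) =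
      - ((-1) ^ card F * of_bool (J F \<noteq> {} \<and> J F \<subseteq> {..<0}) :: real)"
      using fin[OF F] bF[OF F] by (force simp: not_less subset_iff)
  qed
  also have "\<dots> = 0"
    unfolding sum_negf
    using sum_intervals_left_of_zero[of "Pow I" J "\<lambda>F. (-1) ^ card F"] closedJ convexJ 1 insert.hyps
    by simp
  finally show ?case .
qed

section \<open>Edges generate the cone at a vertex\<close>

lemma common_denominator:
  assumes "finite S" "S \<subseteq> \<rat>"
  shows "\<exists>N::nat. 0 < N \<and> (\<forall>q\<in>S. real N * q \<in> \<int>)"
  using assms
proof (induction S)
  case empty
  then show ?case by (intro exI[of _ 1]) auto
next
  case (insert q S)
  then obtain N :: nat where N: "0 < N" "\<forall>q\<in>S. real N * q \<in> \<int>" by auto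
  have "q \<in> \<rat>" using insert.prems by simp
  then obtain a b :: int where ab: "b > 0" "q = of_int a / of_int b" by (rule Rats_cases') auto
  have "real (nat b * N) * q = of_int (int N * a)" using ab by simp
  then have 1: "real (nat b * N) * q \<in> \<int>" by (metis Ints_of_int)
  have 2: "real (nat b * N) * q' \<in> \<int>" if "q' \<in> S" for q'
  proof -
    have "real (nat b * N) * q' = of_nat (nat b) * (real N * q')" by simp
    then show ?thesis using N(2) that by (metis Ints_mult Ints_of_nat)
  qed
  show ?case using 1 2 N(1) ab(1) by (intro exI[of _ "nat b * N"]) auto
qed

text \<open>Clear denominators, then divide by the gcd of the entries; both factors are positive, so
  the direction is kept.\<close>

lemma rational_vec_multiple_primitive:
  fixes x :: "real^'n"
  assumes "x \<noteq> 0" "\<And>i. x $ i \<in> \<rat>"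
  shows "\<exists>c>0. primitive_vec (c *\<^sub>R x)"
proof -
  obtain N :: nat where N: "0 < N" "\<And>i. real N * x $ i \<in> \<int>"
    using common_denominator[of "range (\<lambda>i. x $ i)"] assms(2) by auto
  define u where "u = (\<chi> i. \<lfloor>real N * x $ i\<rfloor>)"
  have u: "of_int (u $ i) = real N * x $ i" for i
    using N(2)[of i] by (simp add: u_def)
  define g where "g = Gcd (range (\<lambda>i. u $ i))"
  obtain i0 where "x $ i0 \<noteq> 0" using assms(1) by (auto simp: vec_eq_iff)
  then have "u $ i0 \<noteq> 0" using u[of i0] N(1) by auto
  then have "g \<noteq> 0" unfolding g_def Gcd_0_iff by auto
  moreover have "g \<ge> 0" by (simp add: g_def)
  ultimately have "g > 0" by simp
  define u' where "u' = (\<chi> i. u $ i div g)"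
  have gu: "u $ i = g * u' $ i" for i
    by (simp add: u'_def g_def)
  have "range (\<lambda>i. u $ i) = (*) g ` range (\<lambda>i. u' $ i)"
    by (simp only: gu image_image)
  then have "g = Gcd ((*) g ` range (\<lambda>i. u' $ i))"
    unfolding g_def by (rule arg_cong)
  also have "\<dots> = normalize (g * Gcd (range (\<lambda>i. u' $ i)))"
    by (rule Gcd_mult)
  finally have "Gcd (range (\<lambda>i. u' $ i)) = 1"
    using \<open>g > 0\<close> by (simp add: abs_mult)
  moreover have "(real N / of_int g) *\<^sub>R x = (\<chi> i. of_int (u' $ i))"
    using \<open>g > 0\<close> u gu by (simp add: vec_eq_iff field_simps)
  ultimately show ?thesis
    using N(1) \<open>g > 0\<close> unfolding primitive_vec_def
    by (intro exI[of _ "real N / of_int g"]) auto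
qed

lemma extreme_point_notin_hull:
  assumes "v \<in> vertices P" "convex P" "S \<subseteq> P - {v}"
  shows "v \<notin> convex hull S"
proof -
  have "convex (P - {v})"
    using assms extreme_point_of_stillconvex by (auto simp: vertices_def)
  then show ?thesis using hull_minimal[of S "P - {v}" convex] assms(3) by auto
qed

text \<open>\<open>S\<close> is a generating set of minimal cardinality; minimality and pointedness make each of its
  rays a face of the cone.\<close>

lemma edges_generate_vertex_cone:
  fixes v :: "'a::euclidean_space"
  assumes fin: "finite V" and vV: "v \<in> V" and v: "v \<notin> convex hull (V - {v})"
  shows "\<exists>S\<subseteq>V - {v}. (\<forall>u\<in>convex hull V. u - v \<in> gcone (\<lambda>s. s - v) S {}) \<and>
    (\<forall>s\<in>S. \<exists>e. e edge_of (convex hull V) \<and> v \<in> e \<and> s \<in> e)"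
proof -
  let ?P = "convex hull V"
  define C where "C S = gcone (\<lambda>s. s - v) S {}" for S
  define G where "G S \<longleftrightarrow> S \<subseteq> V - {v} \<and> (\<forall>u\<in>V. u - v \<in> C S)" for S
  have "G (V - {v})"
  proof -
    have "u - v \<in> C (V - {v})" if "u \<in> V" for u
      using gcone_generator[of "V - {v}" u 1 "{}" "\<lambda>s. s - v"] gcone_zero[of "\<lambda>s. s - v" "V - {v}" "{}"] that fin
      by (cases "u = v") (auto simp: C_def)
    then show ?thesis by (auto simp: G_def)
  qed
  then obtain S where S: "G S" "\<And>T. G T \<Longrightarrow> card S \<le> card T"
    using ex_has_least_nat[of G "V - {v}" card] by auto
  have finS: "finite S" and SV: "S \<subseteq> V - {v}" using S(1) fin finite_subset by (auto simp: G_def)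
  have hull: "u - v \<in> C S" if "u \<in> ?P" for u
  proof -
    have "convex ((\<lambda>u. u + v) ` C S)"
      by (simp add: C_def convex_gcone convex_translation_eq add.commute[of _ v])
    moreover have "V \<subseteq> (\<lambda>u. u + v) ` C S"
      using S(1) by (force simp: G_def image_iff)
    ultimately have "?P \<subseteq> (\<lambda>u. u + v) ` C S" by (intro hull_minimal)
    then show ?thesis using that by auto
  qed
  \<comment> \<open>Dividing a nontrivial nonnegative relation by its coefficient sum would exhibit
    \<open>v\<close> as a convex combination of \<open>S\<close>.\<close>
  have pointed: "\<gamma> r = 0" if "(\<Sum>r\<in>S. \<gamma> r *\<^sub>R (r - v)) = 0" "\<And>r. r \<in> S \<Longrightarrow> 0 \<le> \<gamma> r" "r \<in> S" for \<gamma> r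
  proof (rule ccontr)
    assume "\<gamma> r \<noteq> 0"
    define g where "g = sum \<gamma> S"
    have "g > 0" unfolding g_def using that \<open>\<gamma> r \<noteq> 0\<close> finS by (intro sum_pos2[of _ r]) (auto simp: less_le)
    have "g *\<^sub>R v = (\<Sum>r\<in>S. \<gamma> r *\<^sub>R r)"
      using that(1) by (simp add: scaleR_diff_right sum_subtractf scaleR_sum_left[symmetric] g_def)
    then have "v = (1 / g) *\<^sub>R (\<Sum>r\<in>S. \<gamma> r *\<^sub>R r)" using \<open>g > 0\<close>
      by (metis divide_self_if less_irrefl scaleR_one scaleR_scaleR times_divide_eq_left mult_1)
    then have "v = (\<Sum>r\<in>S. (\<gamma> r / g) *\<^sub>R r)" by (simp add: scaleR_sum_right)
    moreover have "(\<Sum>r\<in>S. \<gamma> r / g) = 1" using \<open>g > 0\<close> by (simp add: sum_divide_distrib[symmetric] g_def)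
    ultimately have "v \<in> convex hull S"
      unfolding convex_hull_finite[OF finS] using that(2) \<open>g > 0\<close>
      by (intro CollectI exI[of _ "\<lambda>r. \<gamma> r / g"]) auto
    then show False using v hull_mono[OF SV, of convex] by auto
  qed
  have minimal: "s - v \<notin> C (S - {s})" if "s \<in> S" for s
  proof
    assume s: "s - v \<in> C (S - {s})"
    have "x \<in> C (S - {s})" if x: "x \<in> C S" for x
    proof -
      obtain \<mu> where \<mu>: "x = (\<Sum>r\<in>S. \<mu> r *\<^sub>R (r - v))" "\<forall>r\<in>S. 0 \<le> \<mu> r"
        using x by (auto simp: C_def gcone_def)
      have "\<mu> r *\<^sub>R (r - v) \<in> C (S - {s})" if "r \<in> S" for r
      proof (cases "r = s")
        case True
        then show ?thesis using s \<mu>(2) that by (auto simp: C_def intro: gcone_scale)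
      next
        case False
        then show ?thesis
          using gcone_generator[of "S - {s}" r "\<mu> r" "{}" "\<lambda>s. s - v"] \<mu>(2) that finS by (auto simp: C_def)
      qed
      then show ?thesis unfolding \<mu>(1) by (simp add: C_def gcone_sum)
    qed
    then have "G (S - {s})" using S(1) by (auto simp: G_def)
    then show False using S(2)[of "S - {s}"] \<open>s \<in> S\<close> finS
      by (metis card_Diff1_less leD)
  qed
  have "\<exists>e. e edge_of ?P \<and> v \<in> e \<and> s \<in> e" if s: "s \<in> S" for s
  proof -
    define e where "e = ?P \<inter> {v + c *\<^sub>R (s - v) | c. 0 \<le> c}"
    have "s \<noteq> v" and sV: "s \<in> V" using s SV by auto
    have ve: "v \<in> e" using vV hull_inc[of v V convex]
      by (auto simp: e_def intro!: exI[of _ 0])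
    have se: "s \<in> e" using sV hull_inc[of s V convex]
      by (auto simp: e_def intro!: exI[of _ 1])
    have "convex {v + c *\<^sub>R (s - v) | c. 0 \<le> c}"
    proof -
      have "{v + c *\<^sub>R (s - v) | c. 0 \<le> c} = (+) v ` ((\<lambda>c. c *\<^sub>R (s - v)) ` {0..})" by auto
      then show ?thesis
        by (simp only:) (intro convex_translation convex_linear_image convex_real_interval
            bounded_linear.linear bounded_linear_scaleR_left)
    qed
    then have conv: "convex e" unfolding e_def by (intro convex_Int convex_convex_hull)
    have face: "a \<in> e \<and> b \<in> e"
      if a: "a \<in> ?P" and b: "b \<in> ?P" and x: "x \<in> e" "x \<in> open_segment a b" for a b x
    proof -
      obtain \<alpha> where \<alpha>: "a - v = (\<Sum>r\<in>S. \<alpha> r *\<^sub>R (r - v))" "\<forall>r\<in>S. 0 \<le> \<alpha> r"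
        using hull[OF a] by (auto simp: C_def gcone_def)
      obtain \<beta> where \<beta>: "b - v = (\<Sum>r\<in>S. \<beta> r *\<^sub>R (r - v))" "\<forall>r\<in>S. 0 \<le> \<beta> r"
        using hull[OF b] by (auto simp: C_def gcone_def)
      obtain u where u: "0 < u" "u < 1" "x = (1 - u) *\<^sub>R a + u *\<^sub>R b"
        using x(2) by (auto simp: in_segment)
      obtain l where l: "0 \<le> l" "x = v + l *\<^sub>R (s - v)" using x(1) by (auto simp: e_def)
      define \<gamma> where "\<gamma> r = (1 - u) * \<alpha> r + u * \<beta> r" for r
      have \<gamma>0: "0 \<le> \<gamma> r" if "r \<in> S" for r using u \<alpha> \<beta> that by (auto simp: \<gamma>_def)
      have "l *\<^sub>R (s - v) = (1 - u) *\<^sub>R (a - v) + u *\<^sub>R (b - v)"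
        using l u by (simp add: algebra_simps)
      also have "\<dots> = (\<Sum>r\<in>S. \<gamma> r *\<^sub>R (r - v))"
        unfolding \<alpha> \<beta> \<gamma>_def by (simp add: scaleR_sum_right sum.distrib scaleR_add_left)
      also have "\<dots> = \<gamma> s *\<^sub>R (s - v) + (\<Sum>r\<in>S - {s}. \<gamma> r *\<^sub>R (r - v))"
        using s finS by (simp add: sum.remove)
      finally have eq: "(l - \<gamma> s) *\<^sub>R (s - v) = (\<Sum>r\<in>S - {s}. \<gamma> r *\<^sub>R (r - v))"
        by (simp add: algebra_simps)
      \<comment> \<open>A positive surplus \<open>l - \<gamma> s\<close> would put
        \<open>s - v\<close> into the cone of the other generators, against minimality.\<close>
      have "\<not> \<gamma> s < l"
      proof
        assume "\<gamma> s < l"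
        have "(1 / (l - \<gamma> s)) *\<^sub>R ((l - \<gamma> s) *\<^sub>R (s - v)) \<in> C (S - {s})"
          unfolding eq C_def using \<open>\<gamma> s < l\<close> \<gamma>0
          by (intro gcone_scale gcone_sum gcone_generator) (use finS in auto)
        then show False using minimal[OF s] \<open>\<gamma> s < l\<close> by simp
      qed
      \<comment> \<open>Bringing \<open>l\<close> to the other side gives a nonnegative relation
        with value 0. Pointedness annihilates it, and since \<open>\<gamma>\<close> mixes
        \<open>\<alpha>\<close> and \<open>\<beta>\<close> with positive weights, both vanish off
        \<open>s\<close>.\<close>
      define \<delta> where "\<delta> = \<gamma>(s := \<gamma> s - l)"
      have "(\<Sum>r\<in>S. \<delta> r *\<^sub>R (r - v)) = \<delta> s *\<^sub>R (s - v) + (\<Sum>r\<in>S - {s}. \<delta> r *\<^sub>R (r - v))"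
        using s finS by (simp add: sum.remove)
      also have "(\<Sum>r\<in>S - {s}. \<delta> r *\<^sub>R (r - v)) = (\<Sum>r\<in>S - {s}. \<gamma> r *\<^sub>R (r - v))"
        by (intro sum.cong) (auto simp: \<delta>_def)
      finally have \<delta>: "(\<Sum>r\<in>S. \<delta> r *\<^sub>R (r - v)) = 0"
        unfolding eq[symmetric] by (simp add: \<delta>_def algebra_simps)
      have \<delta>0: "0 \<le> \<delta> r" if "r \<in> S" for r
        using \<gamma>0 \<open>\<not> \<gamma> s < l\<close> that by (auto simp: \<delta>_def)
      have "\<alpha> r = 0 \<and> \<beta> r = 0" if "r \<in> S" "r \<noteq> s" for r
      proof -
        have "\<gamma> r = 0" using pointed[OF \<delta> \<delta>0 that(1)] that(2) by (simp add: \<delta>_def)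
        then show ?thesis using u \<alpha>(2) \<beta>(2) that(1)
          by (simp add: \<gamma>_def add_nonneg_eq_0_iff)
      qed
      then have "a - v = \<alpha> s *\<^sub>R (s - v)" "b - v = \<beta> s *\<^sub>R (s - v)"
        unfolding \<alpha> \<beta> using s finS by (simp_all add: sum.remove)
      then have "a = v + \<alpha> s *\<^sub>R (s - v)" "b = v + \<beta> s *\<^sub>R (s - v)" by (simp_all add: algebra_simps)
      then show ?thesis unfolding e_def using a b \<alpha>(2) \<beta>(2) s by auto
    qed
    have "e \<subseteq> ?P" by (simp add: e_def)
    with conv face have "e face_of ?P" unfolding face_of_def by blast
    moreover have "aff_dim e = 1"
    proof (rule antisym)
      have "e \<subseteq> affine hull {v, s}"
      proof
        fix x assume "x \<in> e"
        then obtain l where "x = v + l *\<^sub>R (s - v)" by (auto simp: e_def)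
        then have "x = (1 - l) *\<^sub>R v + l *\<^sub>R s" by (simp add: algebra_simps)
        then show "x \<in> affine hull {v, s}" unfolding affine_hull_2 by force
      qed
      then have "aff_dim e \<le> aff_dim (affine hull {v, s})" by (rule aff_dim_subset)
      also have "\<dots> = 1" using \<open>s \<noteq> v\<close> by (simp add: aff_dim_2)
      finally show "aff_dim e \<le> 1" .
      have "aff_dim {v, s} \<le> aff_dim e" using ve se by (intro aff_dim_subset) auto
      then show "1 \<le> aff_dim e" using \<open>s \<noteq> v\<close> by (simp add: aff_dim_2)
    qed
    ultimately show ?thesis using ve se by (auto simp: edge_of_def)
  qed
  then show ?thesis using hull SV by (intro exI[of _ S]) (auto simp: C_def)
qed

lemma polytope_vertices:
  fixes P :: "(real^'n) set"
  assumes "polytope P"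
  shows "finite (vertices P)" "P = convex hull (vertices P)"
proof -
  obtain S where S: "finite S" "P = convex hull S" using assms by (auto simp: polytope_def)
  show "finite (vertices P)"
    unfolding vertices_def using S extreme_point_of_convex_hull
    by (metis (no_types, lifting) finite_subset mem_Collect_eq subsetI)
  show "P = convex hull (vertices P)"
    unfolding vertices_def using S Krein_Milman_polytope by metis
qed

lemma edge_direction_exists:
  fixes P :: "(real^'n) set"
  assumes "e edge_of P" "v \<in> e" "s \<in> e" "s \<noteq> v" "\<forall>i. v $ i \<in> \<rat>" "\<forall>i. s $ i \<in> \<rat>"
  shows "\<exists>c>0. c *\<^sub>R (s - v) \<in> edge_directions P v"
proof -
  obtain c where c: "c > 0" "primitive_vec (c *\<^sub>R (s - v))"
    using rational_vec_multiple_primitive[of "s - v"] assms by auto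
  have "v + (1 / c) *\<^sub>R (c *\<^sub>R (s - v)) \<in> e" using c assms by simp
  then have "c *\<^sub>R (s - v) \<in> edge_directions P v"
    unfolding edge_directions_def using c assms
    by (intro CollectI conjI exI[of _ e] exI[of _ "1 / c"]) auto
  then show ?thesis using c by auto
qed

section \<open>The indicator of a polytope modulo periodic functions\<close>

locale numbered_polytope =
  fixes P :: "(real^'n) set" and w :: "real^'n \<Rightarrow> 'n \<Rightarrow> real^'n"
  assumes rational: "rational_polytope P"
    and full_dim: "aff_dim P = int CARD('n)"
    and numbering: "edge_numbering P w"
begin

lemma polytope: "polytope P"
  using rational by (simp add: rational_polytope_def)

lemma finite_vertices: "finite (vertices P)"
  and hull_vertices: "P = convex hull (vertices P)"
  using polytope_vertices[OF polytope] by auto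

lemma convex_P: "convex P"
  using hull_vertices convex_convex_hull by metis

lemma vertices_subset: "vertices P \<subseteq> P"
  by (auto simp: vertices_def extreme_point_of_def)

lemma edge_vec:
  assumes "v \<in> vertices P"
  shows "w v k \<in> int_lattice" and "\<exists>s>0. v + s *\<^sub>R w v k \<in> P"
proof -
  have "w v k \<in> edge_directions P v"
    using numbering assms unfolding edge_numbering_def by (auto dest: bij_betw_apply)
  then show "w v k \<in> int_lattice" "\<exists>s>0. v + s *\<^sub>R w v k \<in> P"
    by (auto simp: edge_directions_def primitive_vec_def int_lattice_def dest: edge_of_imp_subset)
qed

text \<open>The generators supplied by \<open>edges_generate_vertex_cone\<close> are vertices on
  edges through \<open>v\<close>, so each \<open>s - v\<close> is a positive multiple of some
  \<open>w v k\<close>.\<close>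

lemma vertex_cone:
  assumes v: "v \<in> vertices P" and u: "u \<in> P"
  shows "u - v \<in> gcone (w v) UNIV {}"
proof -
  have "v \<notin> convex hull (vertices P - {v})"
    using v convex_P vertices_subset by (intro extreme_point_notin_hull) auto
  from edges_generate_vertex_cone[OF finite_vertices v this]
  obtain S where S: "S \<subseteq> vertices P - {v}" "\<And>u. u \<in> P \<Longrightarrow> u - v \<in> gcone (\<lambda>s. s - v) S {}"
    "\<And>s. s \<in> S \<Longrightarrow> \<exists>e. e edge_of P \<and> v \<in> e \<and> s \<in> e"
    unfolding hull_vertices[symmetric] by auto
  have *: "s - v \<in> gcone (w v) UNIV {}" if s: "s \<in> S" for s
  proof -
    obtain e where "e edge_of P" "v \<in> e" "s \<in> e" using S(3) s by auto
    then obtain c where c: "c > 0" "c *\<^sub>R (s - v) \<in> edge_directions P v"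
      using edge_direction_exists[of e P v s] s S(1) v rational by (auto simp: rational_polytope_def)
    then obtain k where k: "c *\<^sub>R (s - v) = w v k"
      using numbering v unfolding edge_numbering_def by (metis bij_betw_imp_surj_on imageE)
    have "(1 / c) *\<^sub>R w v k \<in> gcone (w v) UNIV {}"
      using c by (intro gcone_generator) auto
    then show ?thesis using c by (simp add: k[symmetric])
  qed
  obtain \<mu> where "u - v = (\<Sum>s\<in>S. \<mu> s *\<^sub>R (s - v))" "\<forall>s\<in>S. 0 \<le> \<mu> s"
    using S(2)[OF u] by (auto simp: gcone_def)
  then show ?thesis by (auto intro!: gcone_sum gcone_scale *)
qed

text \<open>Full dimension makes the differences \<open>x - v\<close> span the space, and they lie
  in the cone of the edge vectors. A spanning family numbered injectively by the coordinate type has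
  \<open>d\<close> members and so is a basis.\<close>

lemma edge_vec_basis:
  assumes v: "v \<in> vertices P"
  shows "inj (w v)" "independent (range (w v))" "span (range (w v)) = UNIV"
proof -
  show inj: "inj (w v)"
    using numbering v unfolding edge_numbering_def by (auto dest: bij_betw_imp_inj_on)
  let ?Q = "(\<lambda>x. - v + x) ` P"
  have "int (dim ?Q) = int CARD('n)"
    using aff_dim_eq_dim[of v P] v vertices_subset full_dim by (auto simp: hull_inc)
  then have "dim ?Q = dim (UNIV :: (real^'n) set)" by simp
  then have *: "span ?Q = UNIV"
    by (metis dim_eq_full dim_UNIV)
  have "?Q \<subseteq> span (range (w v))"
  proof
    fix x assume "x \<in> ?Q"
    then have "x \<in> gcone (w v) UNIV {}" using vertex_cone[OF v] by auto
    then obtain c where "x = (\<Sum>k\<in>UNIV. c k *\<^sub>R w v k)" by (auto simp: gcone_def)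
    then show "x \<in> span (range (w v))"
      by (simp add: span_sum span_scale span_base)
  qed
  then have "span ?Q \<subseteq> span (range (w v))" by (intro span_minimal) auto
  then show span: "span (range (w v)) = UNIV" using * by auto
  have "card (range (w v)) = dim (UNIV :: (real^'n) set)"
    using inj by (simp add: card_image)
  then show "independent (range (w v))"
    using card_eq_dim[of "range (w v)" UNIV] span by simp
qed

end

lemma basis_coordinates:
  fixes u :: "'n::finite \<Rightarrow> 'a::real_vector"
  assumes "inj u" "independent (range u)" "span (range u) = UNIV"
  obtains l where "\<And>x. (\<Sum>k\<in>UNIV. l x k *\<^sub>R u k) = x" "\<And>c. l (\<Sum>k\<in>UNIV. c k *\<^sub>R u k) = c"
proof -
  have ex: "\<exists>c. (\<Sum>k\<in>UNIV. c k *\<^sub>R u k) = x" for x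
  proof -
    have "x \<in> span (range u)" using assms by simp
    then obtain c where "x = (\<Sum>y\<in>range u. c y *\<^sub>R y)"
      by (auto simp: span_finite)
    also have "\<dots> = (\<Sum>k\<in>UNIV. c (u k) *\<^sub>R u k)" using assms(1) by (simp add: sum.reindex)
    finally show ?thesis by metis
  qed
  then obtain l where l: "\<And>x. (\<Sum>k\<in>UNIV. l x k *\<^sub>R u k) = x" by metis
  have "l (\<Sum>k\<in>UNIV. c k *\<^sub>R u k) = c" for c
  proof
    fix j
    define d where "d k = l (\<Sum>k\<in>UNIV. c k *\<^sub>R u k) k - c k" for k
    have "(\<Sum>k\<in>UNIV. d k *\<^sub>R u k) = 0" by (simp add: d_def scaleR_diff_left sum_subtractf l)
    then have "(\<Sum>y\<in>range u. d (inv u y) *\<^sub>R y) = 0" using assms(1) by (simp add: sum.reindex)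
    then have "d (inv u (u j)) = 0"
      using assms(2) independentD[of "range u" "range u" "\<lambda>y. d (inv u y)" "u j"] by auto
    then show "l (\<Sum>k\<in>UNIV. c k *\<^sub>R u k) j = c j" using assms(1) by (simp add: d_def)
  qed
  with l that show ?thesis by blast
qed

lemma gcone_mono: "F \<subseteq> G \<Longrightarrow> gcone a I F \<subseteq> gcone a I G"
  unfolding gcone_def by blast

text \<open>Separates the three roles in the alternating sum: the polytope (\<open>{}\<close>), the
  vertex cones (singletons), and the sets that contain lines (two or more vertices).\<close>

lemma Pow_by_card:
  assumes "finite V"
  shows "(\<Sum>F\<in>Pow V. g F) = g {} + (\<Sum>v\<in>V. g {v}) + (\<Sum>F | F \<subseteq> V \<and> 2 \<le> card F. g F :: 'c::comm_monoid_add)"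
proof -
  have "Pow V = insert {} ((\<lambda>v. {v}) ` V) \<union> {F. F \<subseteq> V \<and> 2 \<le> card F}"
  proof (intro equalityI subsetI)
    fix F assume F: "F \<in> Pow V"
    then have "finite F" using assms finite_subset by auto
    then have "card F = 0 \<longrightarrow> F = {}" "card F = 1 \<longrightarrow> (\<exists>v. F = {v})" using card_1_singletonE by auto
    moreover have "card F = 0 \<or> card F = 1 \<or> 2 \<le> card F" by auto
    ultimately show "F \<in> insert {} ((\<lambda>v. {v}) ` V) \<union> {F. F \<subseteq> V \<and> 2 \<le> card F}"
      using F by auto
  qed auto
  moreover have "finite {F. F \<subseteq> V \<and> 2 \<le> card F}"
    using assms by (auto intro: finite_subset[of _ "Pow V"])
  ultimately have "(\<Sum>F\<in>Pow V. g F) = (\<Sum>F\<in>insert {} ((\<lambda>v. {v}) ` V). g F)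
      + (\<Sum>F | F \<subseteq> V \<and> 2 \<le> card F. g F)"
    using assms by (simp only:) (intro sum.union_disjoint, auto)
  also have "(\<Sum>F\<in>insert {} ((\<lambda>v. {v}) ` V). g F) = g {} + (\<Sum>v\<in>V. g {v})"
    using assms by (subst sum.insert) (auto simp: sum.reindex)
  finally show ?thesis .
qed

section \<open>Homogenized cones and the decomposition of the indicator\<close>

context numbered_polytope
begin

text \<open>The set \<open>K F\<close> of the introduction is the slice at height \<open>1\<close>.\<close>

definition face_cone :: "(real^'n) set \<Rightarrow> ((real^'n) \<times> real) set"
  where "face_cone F = gcone (\<lambda>v. (v, 1)) (vertices P) F"

text \<open>A combination with negative coefficients only has nonpositive last coordinate and
  therefore misses height 1.\<close>

lemma alternating_sum_face_cone:
  "(\<Sum>F\<in>Pow (vertices P). (-1) ^ card F * of_bool ((x, 1) \<in> face_cone F)) = (0::real)"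
  unfolding face_cone_def
proof (rule alternating_sum_gcone[OF finite_vertices])
  fix \<mu> :: "real^'n \<Rightarrow> real" assume "\<And>i. i \<in> vertices P \<Longrightarrow> \<mu> i < 0"
  then have "(\<Sum>i\<in>vertices P. \<mu> i) \<le> 0" by (intro sum_nonpos) force
  then show "(x, 1 :: real) \<noteq> (\<Sum>i\<in>vertices P. \<mu> i *\<^sub>R (i, 1))"
    by (auto simp: prod_eq_iff snd_sum fst_sum)
qed

lemma face_cone_empty: "(x, 1) \<in> face_cone {} \<longleftrightarrow> x \<in> P"
proof -
  have "(x, 1) \<in> face_cone {} \<longleftrightarrow>
    (\<exists>\<mu>. (\<forall>i\<in>vertices P. 0 \<le> \<mu> i) \<and> sum \<mu> (vertices P) = 1 \<and> (\<Sum>i\<in>vertices P. \<mu> i *\<^sub>R i) = x)"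
    unfolding face_cone_def gcone_def by (auto simp: prod_eq_iff snd_sum fst_sum)
  also have "\<dots> \<longleftrightarrow> x \<in> convex hull (vertices P)"
    by (simp add: convex_hull_finite[OF finite_vertices])
  finally show ?thesis using hull_vertices by simp
qed

text \<open>The free coefficient of \<open>v\<close> allows subtracting \<open>(v, 1)\<close>. From
  a point of the polytope along the edge, placed at height 1, this leaves a positive multiple of the
  edge vector.\<close>

lemma edge_in_face_cone:
  assumes "v \<in> F" "v \<in> vertices P"
  shows "(w v k, 0) \<in> face_cone F"
proof -
  obtain s where s: "s > 0" "v + s *\<^sub>R w v k \<in> P" using edge_vec(2)[OF assms(2)] by auto
  have "(v + s *\<^sub>R w v k, 1) \<in> face_cone F"
    using s(2) gcone_mono[of "{}" F] unfolding face_cone_empty[symmetric] face_cone_def by auto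
  moreover have "(-1) *\<^sub>R (v, 1) \<in> face_cone F"
    unfolding face_cone_def using assms finite_vertices by (intro gcone_generator) auto
  ultimately have "(v + s *\<^sub>R w v k, 1) + (-1) *\<^sub>R (v, 1) \<in> face_cone F"
    unfolding face_cone_def by (rule gcone_add)
  then have "(s *\<^sub>R w v k, 0) \<in> face_cone F" by simp
  then have "(1 / s) *\<^sub>R (s *\<^sub>R w v k, 0 :: real) \<in> face_cone F"
    using s(1) unfolding face_cone_def by (intro gcone_scale) auto
  then show ?thesis using s(1) by simp
qed

text \<open>At height 1 the coefficients sum to 1, so subtracting \<open>v\<close> eliminates its
  free coefficient and leaves a nonnegative combination of the vectors \<open>i - v\<close>.
  Conversely, edge vectors at height 0 are added to \<open>(v, 1)\<close>.\<close>

lemma face_cone_singleton: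
  assumes v: "v \<in> vertices P"
  shows "(x, 1) \<in> face_cone {v} \<longleftrightarrow> x - v \<in> gcone (w v) UNIV {}"
proof
  assume "(x, 1) \<in> face_cone {v}"
  then obtain \<mu> where \<mu>: "x = (\<Sum>i\<in>vertices P. \<mu> i *\<^sub>R i)" "(\<Sum>i\<in>vertices P. \<mu> i) = 1"
    "\<And>i. i \<in> vertices P \<Longrightarrow> i \<noteq> v \<Longrightarrow> 0 \<le> \<mu> i"
    unfolding face_cone_def gcone_def by (auto simp: prod_eq_iff snd_sum fst_sum)
  have "x - v = (\<Sum>i\<in>vertices P. \<mu> i *\<^sub>R (i - v))"
    using \<mu>(2) by (simp add: \<mu>(1) scaleR_diff_right sum_subtractf scaleR_sum_left[symmetric])
  moreover have "\<mu> i *\<^sub>R (i - v) \<in> gcone (w v) UNIV {}" if "i \<in> vertices P" for i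
  proof (cases "i = v")
    case False
    then show ?thesis using that \<mu>(3) vertex_cone[OF v] vertices_subset by (intro gcone_scale) auto
  qed (simp add: gcone_zero)
  ultimately show "x - v \<in> gcone (w v) UNIV {}" by (auto intro: gcone_sum)
next
  assume "x - v \<in> gcone (w v) UNIV {}"
  then obtain l where l: "x - v = (\<Sum>k\<in>UNIV. l k *\<^sub>R w v k)" "\<And>k. 0 \<le> l k"
    by (auto simp: gcone_def)
  have "(\<Sum>k\<in>UNIV. l k *\<^sub>R (w v k, 0 :: real)) \<in> face_cone {v}"
    using edge_in_face_cone[of v "{v}"] v l(2) unfolding face_cone_def
    by (intro gcone_sum gcone_scale) auto
  moreover have "(v, 1) \<in> face_cone {v}"
    using gcone_generator[OF finite_vertices v, of 1 "{v}" "\<lambda>v. (v, 1 :: real)"]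
    by (simp add: face_cone_def)
  ultimately have "(v, 1) + (\<Sum>k\<in>UNIV. l k *\<^sub>R (w v k, 0 :: real)) \<in> face_cone {v}"
    unfolding face_cone_def by (intro gcone_add)
  also have "(v, 1) + (\<Sum>k\<in>UNIV. l k *\<^sub>R (w v k, 0 :: real)) = (x, 1)"
    using l(1) by (auto simp: prod_eq_iff fst_sum snd_sum algebra_simps)
  finally show "(x, 1) \<in> face_cone {v}" .
qed

text \<open>If \<open>v, v' \<in> F\<close>, the cone contains \<open>v - v'\<close>, which is minus a nonnegative combination of the
  edge vectors at \<open>v\<close>; so it contains \<open>- w v k\<close> for any \<open>k\<close> with a positive coefficient.\<close>

lemma face_cone_line:
  assumes F: "F \<subseteq> vertices P" "2 \<le> card F"
  shows "\<exists>v\<in>vertices P. \<exists>k. \<forall>c y. y + (c *\<^sub>R w v k, 0) \<in> face_cone F \<longleftrightarrow> y \<in> face_cone F"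
proof -
  obtain v v' where vv: "v \<in> F" "v' \<in> F" "v \<noteq> v'"
    using F(2) by (metis One_nat_def Suc_1 card_le_Suc0_iff_eq card.infinite not_less_eq_eq zero_le)
  then have v: "v \<in> vertices P" "v' \<in> vertices P" using F by auto
  have "v' - v \<in> gcone (w v) UNIV {}" using vertex_cone v vertices_subset by auto
  then obtain l where l: "v' - v = (\<Sum>k\<in>UNIV. l k *\<^sub>R w v k)" "\<And>k. 0 \<le> l k"
    by (auto simp: gcone_def)
  obtain k where "l k \<noteq> 0" using l vv(3) by force
  then have k: "l k > 0" using l(2)[of k] by simp
  have w: "(w v j, 0) \<in> face_cone F" for j by (rule edge_in_face_cone[OF vv(1) v(1)])
  have "(1::real) *\<^sub>R (v, 1::real) \<in> face_cone F" "(-1) *\<^sub>R (v', 1::real) \<in> face_cone F"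
    unfolding face_cone_def using vv v finite_vertices by (intro gcone_generator; simp)+
  then have 1: "1 *\<^sub>R (v, 1) + (-1) *\<^sub>R (v', 1) \<in> face_cone F"
    unfolding face_cone_def by (rule gcone_add)
  have 2: "(\<Sum>j\<in>UNIV - {k}. l j *\<^sub>R (w v j, 0)) \<in> face_cone F"
    using w l(2) unfolding face_cone_def by (intro gcone_sum gcone_scale) auto
  have "(v' - v, 0 :: real) = l k *\<^sub>R (w v k, 0) + (\<Sum>j\<in>UNIV - {k}. l j *\<^sub>R (w v j, 0))"
    by (simp add: prod_eq_iff fst_sum snd_sum l(1) sum.remove[of UNIV k])
  then have "(1 *\<^sub>R (v, 1) + (-1) *\<^sub>R (v', 1)) + (\<Sum>j\<in>UNIV - {k}. l j *\<^sub>R (w v j, 0)) = l k *\<^sub>R (- w v k, 0 :: real)"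
    by (auto simp: prod_eq_iff algebra_simps)
  then have lm: "l k *\<^sub>R (- w v k, 0 :: real) \<in> face_cone F"
    using gcone_add[OF 1[unfolded face_cone_def] 2[unfolded face_cone_def]] by (simp add: face_cone_def)
  have "(1 / l k) *\<^sub>R (l k *\<^sub>R (- w v k, 0 :: real)) \<in> face_cone F"
    using k lm unfolding face_cone_def by (intro gcone_scale[OF lm[unfolded face_cone_def]]) simp
  then have m: "(- w v k, 0) \<in> face_cone F" using k by simp
  have c: "(c *\<^sub>R w v k, 0) \<in> face_cone F" for c
  proof (cases "0 \<le> c")
    case True
    then show ?thesis using gcone_scale[OF w[unfolded face_cone_def], of c k] by (simp add: face_cone_def)
  next
    case False
    then show ?thesis using gcone_scale[OF m[unfolded face_cone_def], of "- c"] by (simp add: face_cone_def)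
  qed
  have "y + (c *\<^sub>R w v k, 0) \<in> face_cone F \<longleftrightarrow> y \<in> face_cone F" for c y
  proof
    assume "y + (c *\<^sub>R w v k, 0) \<in> face_cone F"
    then have "(y + (c *\<^sub>R w v k, 0)) + ((- c) *\<^sub>R w v k, 0) \<in> face_cone F"
      using c[of "- c"] unfolding face_cone_def by (rule gcone_add)
    then show "y \<in> face_cone F" by (simp add: add.assoc zero_prod_def[symmetric])
  next
    assume "y \<in> face_cone F"
    then show "y + (c *\<^sub>R w v k, 0) \<in> face_cone F"
      using c[of c] unfolding face_cone_def by (rule gcone_add)
  qed
  then show ?thesis using v(1) by blast
qed

text \<open>The alternating identity at \<open>(1 / t) *\<^sub>R p\<close>, solved for the term of
  the empty set. The vertex terms have sign -1, hence turn up with a plus; positive rescaling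
  preserves the vertex cones.\<close>

lemma indicator_decomposition:
  assumes "t > 0"
  shows "of_bool (p \<in> (\<lambda>x. t *\<^sub>R x) ` P) =
    (\<Sum>v\<in>vertices P. of_bool (p - t *\<^sub>R v \<in> gcone (w v) UNIV {})) -
    (\<Sum>F | F \<subseteq> vertices P \<and> 2 \<le> card F. (-1) ^ card F * of_bool (((1 / t) *\<^sub>R p, 1) \<in> face_cone F) :: real)"
proof -
  let ?x = "(1 / t) *\<^sub>R p"
  have 1: "p \<in> (\<lambda>x. t *\<^sub>R x) ` P \<longleftrightarrow> (?x, 1) \<in> face_cone {}"
    using assms by (force simp: face_cone_empty image_iff)
  have 2: "p - t *\<^sub>R v \<in> gcone (w v) UNIV {} \<longleftrightarrow> (?x, 1) \<in> face_cone {v}" if "v \<in> vertices P" for v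
  proof -
    have "p - t *\<^sub>R v = t *\<^sub>R (?x - v)" "?x - v = (1 / t) *\<^sub>R (p - t *\<^sub>R v)"
      using assms by (auto simp: scaleR_diff_right)
    then show ?thesis
      using gcone_scale[of "?x - v" "w v" UNIV "{}" t] gcone_scale[of "p - t *\<^sub>R v" "w v" UNIV "{}" "1 / t"] assms
      unfolding face_cone_singleton[OF that] by force
  qed
  have "(\<Sum>v\<in>vertices P. of_bool (p - t *\<^sub>R v \<in> gcone (w v) UNIV {}) :: real)
      = (\<Sum>v\<in>vertices P. of_bool ((?x, 1) \<in> face_cone {v}))"
    by (intro sum.cong) (auto simp: 2)
  then show ?thesis
    using alternating_sum_face_cone[of ?x]
    unfolding Pow_by_card[OF finite_vertices] 1 by (simp add: sum_negf)
qed

end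

section \<open>Formal exponential sums over the lattice\<close>

text \<open>On generating functions this becomes multiplication by \<open>1 - exp_fps z w\<close>:
  the formal substitute for clearing one denominator of a rational function.\<close>

definition ldiff :: "real^'n \<Rightarrow> (real^'n \<Rightarrow> complex) \<Rightarrow> real^'n \<Rightarrow> complex"
  where "ldiff w f p = f p - f (p - w)"

abbreviation ldiffs :: "(real^'n) list \<Rightarrow> (real^'n \<Rightarrow> complex) \<Rightarrow> real^'n \<Rightarrow> complex"
  where "ldiffs \<equiv> foldr ldiff"

definition exp_fps :: "complex^'n \<Rightarrow> real^'n \<Rightarrow> complex fps"
  where "exp_fps z p = fps_exp (pairing p z)"

definition lat_sum :: "complex^'n \<Rightarrow> (real^'n \<Rightarrow> complex) \<Rightarrow> complex fps"
  where "lat_sum z f = (\<Sum>p | f p \<noteq> 0. fps_const (f p) * exp_fps z p)"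

text \<open>\<open>s\<close> stands for \<open>X\<^sup>d\<close> times the sum of \<open>f p * exp (X * pairing p z)\<close>.  The factor clears the
  pole of order \<open>d\<close> that cones produce, so that no Laurent series are needed.\<close>

definition gen_sum :: "complex^'n \<Rightarrow> (real^'n \<Rightarrow> complex) \<Rightarrow> complex fps \<Rightarrow> bool"
  where "gen_sum z f s \<longleftrightarrow> (\<exists>ws. (\<forall>w\<in>set ws. pairing w z \<noteq> 0) \<and> finite {p. ldiffs ws f p \<noteq> 0} \<and>
    fps_X ^ CARD('n) * lat_sum z (ldiffs ws f) = (\<Prod>w\<leftarrow>ws. 1 - exp_fps z w) * s)"

lemma pairing_add: "pairing (x + y) z = pairing x z + pairing y z"
  and pairing_diff: "pairing (x - y) z = pairing x z - pairing y z"
  and pairing_scale: "pairing (c *\<^sub>R x) z = of_real c * pairing x z"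
  by (simp_all add: pairing_def sum.distrib sum_subtractf sum_distrib_left algebra_simps)

lemma exp_fps_add: "exp_fps z (p + q) = exp_fps z p * exp_fps z q"
  by (simp add: exp_fps_def pairing_add fps_exp_add_mult)

text \<open>The coefficient of degree one is \<open>- pairing w z\<close>. The factor can therefore
  be cancelled in the integral domain of power series.\<close>

lemma exp_fps_neq_1: "pairing w z \<noteq> 0 \<Longrightarrow> 1 - exp_fps z w \<noteq> 0"
proof
  assume "pairing w z \<noteq> 0" "1 - exp_fps z w = 0"
  then have "fps_nth (1 - exp_fps z w) 1 = 0" by simp
  then show False using \<open>pairing w z \<noteq> 0\<close> by (simp add: exp_fps_def)
qed

lemma lat_sum_superset:
  assumes "finite A" "{p. f p \<noteq> 0} \<subseteq> A"
  shows "lat_sum z f = (\<Sum>p\<in>A. fps_const (f p) * exp_fps z p)"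
  unfolding lat_sum_def using assms by (intro sum.mono_neutral_left) auto

lemma lat_sum_add:
  assumes "finite {p. f p \<noteq> 0}" "finite {p. g p \<noteq> 0}"
  shows "lat_sum z (\<lambda>p. f p + g p) = lat_sum z f + lat_sum z g"
proof -
  let ?A = "{p. f p \<noteq> 0} \<union> {p. g p \<noteq> 0}"
  have "lat_sum z (\<lambda>p. f p + g p) = (\<Sum>p\<in>?A. fps_const (f p + g p) * exp_fps z p)"
    using assms by (intro lat_sum_superset) auto
  also have "\<dots> = (\<Sum>p\<in>?A. fps_const (f p) * exp_fps z p) + (\<Sum>p\<in>?A. fps_const (g p) * exp_fps z p)"
    by (simp add: sum.distrib[symmetric] distrib_right[symmetric])
  also have "\<dots> = lat_sum z f + lat_sum z g"
    using assms by (intro arg_cong2[of _ _ _ _ "(+)"] lat_sum_superset[symmetric]) auto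
  finally show ?thesis .
qed

lemma lat_sum_cmult: "lat_sum z (\<lambda>p. c * f p) = fps_const c * lat_sum z f"
proof (cases "c = 0")
  case False
  then show ?thesis
    by (simp add: lat_sum_def sum_distrib_left fps_const_mult[symmetric] mult.assoc del: fps_const_mult)
qed (simp add: lat_sum_def)

lemma finite_supp_shift: "finite {p. f p \<noteq> 0} \<Longrightarrow> finite {p. f (p - w) \<noteq> (0::complex)}"
  for w :: "real^'n"
proof -
  assume "finite {p. f p \<noteq> 0}"
  then have "finite ((\<lambda>p. p + w) ` {p. f p \<noteq> 0})" by simp
  moreover have "{p. f (p - w) \<noteq> 0} \<subseteq> (\<lambda>p. p + w) ` {p. f p \<noteq> 0}"
    by (auto simp: image_iff intro!: exI[of _ "_ - w"])
  ultimately show ?thesis by (rule rev_finite_subset)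
qed

lemma lat_sum_shift: "lat_sum z (\<lambda>p. f (p - w)) = exp_fps z w * lat_sum z f"
  unfolding lat_sum_def sum_distrib_left
  by (rule sum.reindex_bij_witness[of _ "\<lambda>p. p + w" "\<lambda>p. p - w"])
    (auto simp: exp_fps_add[symmetric] mult.left_commute[of "exp_fps z w"])

lemma ldiff_finite_support:
  assumes "finite {p. f p \<noteq> 0}"
  shows "finite {p. ldiff w f p \<noteq> 0}" "lat_sum z (ldiff w f) = (1 - exp_fps z w) * lat_sum z f"
proof -
  have "{p. ldiff w f p \<noteq> 0} \<subseteq> {p. f p \<noteq> 0} \<union> {p. f (p - w) \<noteq> 0}"
    by (auto simp: ldiff_def)
  then show "finite {p. ldiff w f p \<noteq> 0}"
    using assms finite_supp_shift[OF assms] by (meson finite_UnI finite_subset)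
  have eq: "ldiff w f = (\<lambda>p. f p + (-1) * f (p - w))" by (auto simp: ldiff_def)
  have "lat_sum z (ldiff w f) = lat_sum z f + lat_sum z (\<lambda>p. (-1) * f (p - w))"
    unfolding eq using assms finite_supp_shift[OF assms, of w] by (intro lat_sum_add) auto
  also have "\<dots> = (1 - exp_fps z w) * lat_sum z f"
    unfolding lat_sum_cmult lat_sum_shift by (simp add: algebra_simps fps_const_neg[symmetric] del: fps_const_neg)
  finally show "lat_sum z (ldiff w f) = (1 - exp_fps z w) * lat_sum z f" .
qed

lemma ldiffs_finite_support:
  assumes "finite {p. f p \<noteq> 0}"
  shows "finite {p. ldiffs ws f p \<noteq> 0}"
    and "lat_sum z (ldiffs ws f) = (\<Prod>w\<leftarrow>ws. 1 - exp_fps z w) * lat_sum z f"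
proof -
  have "finite {p. ldiffs ws f p \<noteq> 0} \<and> lat_sum z (ldiffs ws f) = (\<Prod>w\<leftarrow>ws. 1 - exp_fps z w) * lat_sum z f"
    using assms by (induction ws) (auto simp: ldiff_finite_support mult.assoc)
  then show "finite {p. ldiffs ws f p \<noteq> 0}"
    "lat_sum z (ldiffs ws f) = (\<Prod>w\<leftarrow>ws. 1 - exp_fps z w) * lat_sum z f" by auto
qed

lemma ldiff_commute: "ldiff u (ldiff w f) = ldiff w (ldiff u f)"
  by (auto simp: ldiff_def algebra_simps fun_eq_iff)

lemma ldiffs_commute: "ldiffs us (ldiffs ws f) = ldiffs ws (ldiffs us f)"
proof (induction us)
  case (Cons u us)
  have "ldiff u (ldiffs ws g) = ldiffs ws (ldiff u g)" for g
    by (induction ws) (auto simp: ldiff_commute[of u])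
  then show ?case using Cons by simp
qed simp

lemma ldiffs_add: "ldiffs ws (\<lambda>p. f p + g p) = (\<lambda>p. ldiffs ws f p + ldiffs ws g p)"
  by (induction ws) (auto simp: ldiff_def fun_eq_iff)

lemma ldiffs_cmult: "ldiffs ws (\<lambda>p. c * f p) = (\<lambda>p. c * ldiffs ws f p)"
  by (induction ws) (auto simp: ldiff_def fun_eq_iff algebra_simps)

section \<open>Linearity and uniqueness of the formal summation\<close>

lemma gen_sum_add:
  fixes z :: "complex^'n"
  assumes "gen_sum z f s" "gen_sum z g t"
  shows "gen_sum z (\<lambda>p. f p + g p) (s + t)"
proof -
  obtain us where us: "\<forall>w\<in>set us. pairing w z \<noteq> 0" "finite {p. ldiffs us f p \<noteq> 0}"
    "fps_X ^ CARD('n) * lat_sum z (ldiffs us f) = (\<Prod>w\<leftarrow>us. 1 - exp_fps z w) * s"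
    using assms(1) by (auto simp: gen_sum_def)
  obtain ws where ws: "\<forall>w\<in>set ws. pairing w z \<noteq> 0" "finite {p. ldiffs ws g p \<noteq> 0}"
    "fps_X ^ CARD('n) * lat_sum z (ldiffs ws g) = (\<Prod>w\<leftarrow>ws. 1 - exp_fps z w) * t"
    using assms(2) by (auto simp: gen_sum_def)
  let ?f = "ldiffs ws (ldiffs us f)" and ?g = "ldiffs us (ldiffs ws g)"
  \<comment> \<open>The concatenated list serves both summands: each is first made finitely
    supported by its own list, and the other list preserves this. Commutativity allows choosing the
    order separately.\<close>
  have eq: "ldiffs (us @ ws) (\<lambda>p. f p + g p) = (\<lambda>p. ?f p + ?g p)"
    by (simp add: ldiffs_add ldiffs_commute)
  note fin = ldiffs_finite_support(1)[OF us(2), of ws] ldiffs_finite_support(1)[OF ws(2), of us]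
  have "finite {p. ldiffs (us @ ws) (\<lambda>p. f p + g p) p \<noteq> 0}"
    unfolding eq by (rule finite_subset[OF _ finite_UnI[OF fin]]) auto
  moreover have "fps_X ^ CARD('n) * lat_sum z (ldiffs (us @ ws) (\<lambda>p. f p + g p))
    = (\<Prod>w\<leftarrow>ws. 1 - exp_fps z w) * (fps_X ^ CARD('n) * lat_sum z (ldiffs us f))
      + (\<Prod>w\<leftarrow>us. 1 - exp_fps z w) * (fps_X ^ CARD('n) * lat_sum z (ldiffs ws g))"
    unfolding eq lat_sum_add[OF fin] ldiffs_finite_support(2)[OF us(2)] ldiffs_finite_support(2)[OF ws(2)]
    by (simp add: algebra_simps)
  moreover have "\<dots> = (\<Prod>w\<leftarrow>us @ ws. 1 - exp_fps z w) * (s + t)"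
    unfolding us ws by (simp add: algebra_simps)
  ultimately show ?thesis
    unfolding gen_sum_def using us(1) ws(1) by (intro exI[of _ "us @ ws"]) auto
qed

lemma gen_sum_cmult:
  fixes z :: "complex^'n"
  assumes "gen_sum z f s"
  shows "gen_sum z (\<lambda>p. c * f p) (fps_const c * s)"
proof -
  obtain us where us: "\<forall>w\<in>set us. pairing w z \<noteq> 0" "finite {p. ldiffs us f p \<noteq> 0}"
    "fps_X ^ CARD('n) * lat_sum z (ldiffs us f) = (\<Prod>w\<leftarrow>us. 1 - exp_fps z w) * s"
    using assms by (auto simp: gen_sum_def)
  have "finite {p. c * ldiffs us f p \<noteq> 0}" by (rule finite_subset[OF _ us(2)]) auto
  moreover have "fps_X ^ CARD('n) * (fps_const c * lat_sum z (ldiffs us f))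
      = fps_const c * (fps_X ^ CARD('n) * lat_sum z (ldiffs us f))" by (simp only: mult.left_commute)
  ultimately show ?thesis
    unfolding gen_sum_def using us(1)
    by (intro exI[of _ us]) (simp add: ldiffs_cmult lat_sum_cmult us(3) mult.left_commute)
qed

lemma gen_sum_zero: "gen_sum z (\<lambda>p. 0) 0"
  unfolding gen_sum_def by (intro exI[of _ "[]"]) (auto simp: lat_sum_def)

lemma gen_sum_sum:
  assumes "\<And>i. i \<in> I \<Longrightarrow> gen_sum z (f i) (s i)"
  shows "gen_sum z (\<lambda>p. \<Sum>i\<in>I. f i p) (\<Sum>i\<in>I. s i)"
  using assms by (induction I rule: infinite_finite_induct) (auto simp: gen_sum_zero gen_sum_add)

lemma gen_sum_finite:
  fixes z :: "complex^'n"
  assumes "finite {p. f p \<noteq> 0}"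
  shows "gen_sum z f (fps_X ^ CARD('n) * lat_sum z f)"
  unfolding gen_sum_def using assms by (intro exI[of _ "[]"]) auto

text \<open>A single difference along the period annihilates \<open>f\<close>. This is how every set
  invariant along an edge drops out of the final formula.\<close>

lemma gen_sum_periodic:
  assumes "pairing w z \<noteq> 0" "\<And>p. f (p - w) = f p"
  shows "gen_sum z f 0"
  unfolding gen_sum_def using assms
  by (intro exI[of _ "[w]"]) (auto simp: lat_sum_def ldiff_def)

text \<open>By linearity \<open>s - t\<close> is a formal sum of the zero function. All differences
  of that function vanish, while the product of the factors does not.\<close>

lemma gen_sum_unique:
  fixes z :: "complex^'n"
  assumes "gen_sum z f s" "gen_sum z f t"
  shows "s = t"
proof -
  have "gen_sum z (\<lambda>p. f p + (-1) * f p) (s + fps_const (-1) * t)"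
    using assms by (intro gen_sum_add gen_sum_cmult)
  then have "gen_sum z (\<lambda>p. 0) (s - t)"
    by (simp add: fps_const_neg[symmetric] del: fps_const_neg)
  then obtain us where us: "\<forall>w\<in>set us. pairing w z \<noteq> 0"
    "fps_X ^ CARD('n) * lat_sum z (ldiffs us (\<lambda>p. 0)) = (\<Prod>w\<leftarrow>us. 1 - exp_fps z w) * (s - t)"
    by (auto simp: gen_sum_def)
  have "ldiffs us (\<lambda>p. 0) = (\<lambda>p. 0)" by (induction us) (auto simp: ldiff_def)
  then have "(\<Prod>w\<leftarrow>us. 1 - exp_fps z w) * (s - t) = 0" using us(2) by (simp add: lat_sum_def)
  moreover have "(\<Prod>w\<leftarrow>us. 1 - exp_fps z w) \<noteq> 0"
  proof
    assume "(\<Prod>w\<leftarrow>us. 1 - exp_fps z w) = 0"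
    then obtain w where "w \<in> set us" "1 - exp_fps z w = 0"
      by (auto simp: prod_list_zero_iff)
    then show False using us(1) exp_fps_neq_1 by blast
  qed
  ultimately show ?thesis by simp
qed

section \<open>Lattice points in boxes and the formal sum of a cone\<close>

lemma finite_bounded_int_lattice:
  fixes S :: "(real^'n) set"
  assumes "bounded S"
  shows "finite (S \<inter> int_lattice)"
proof -
  obtain B where B: "\<And>x. x \<in> S \<Longrightarrow> norm x \<le> B" using assms by (auto simp: bounded_iff)
  let ?A = "real_of_int ` {-\<lceil>B\<rceil>..\<lceil>B\<rceil>}"
  have "S \<inter> int_lattice \<subseteq> vec_lambda ` (UNIV \<rightarrow>\<^sub>E ?A)"
  proof
    fix x assume x: "x \<in> S \<inter> int_lattice"
    have "x $ i \<in> ?A" for i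
    proof -
      obtain n where n: "x $ i = of_int n" using x by (auto simp: int_lattice_def elim: Ints_cases)
      have "\<bar>x $ i\<bar> \<le> B" using B x component_le_norm_cart[of x i] by fastforce
      then have "\<bar>n\<bar> \<le> \<lceil>B\<rceil>" unfolding n by linarith
      then show ?thesis unfolding n by (intro imageI) auto
    qed
    then have "(\<lambda>i. x $ i) \<in> UNIV \<rightarrow>\<^sub>E ?A" by auto
    then show "x \<in> vec_lambda ` (UNIV \<rightarrow>\<^sub>E ?A)" by (intro image_eqI[of _ _ "\<lambda>i. x $ i"]) auto
  qed
  then show ?thesis by (rule finite_subset) (intro finite_imageI finite_PiE, auto)
qed

lemma bounded_half_open_box: "bounded (half_open_box u)"
proof -
  have "norm x \<le> (\<Sum>k\<in>UNIV. norm (u k))" if x: "x \<in> half_open_box u" for x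
  proof -
    obtain l where l: "\<forall>k. 0 \<le> l k \<and> l k < 1" "x = (\<Sum>k\<in>UNIV. l k *\<^sub>R u k)"
      using x by (auto simp: half_open_box_def)
    have "norm x \<le> (\<Sum>k\<in>UNIV. norm (l k *\<^sub>R u k))" unfolding l(2) by (rule norm_sum)
    also have "\<dots> \<le> (\<Sum>k\<in>UNIV. norm (u k))"
      using l(1) by (intro sum_mono) (auto intro!: mult_left_le_one_le simp: less_imp_le)
    finally show ?thesis .
  qed
  then show ?thesis by (auto simp: bounded_iff)
qed

lemma int_lattice_diff:
  assumes "w \<in> int_lattice"
  shows "p - w \<in> int_lattice \<longleftrightarrow> p \<in> int_lattice"
proof -
  have "x - y \<in> \<int> \<longleftrightarrow> x \<in> \<int>" if "y \<in> \<int>" for x y :: real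
    using that by (metis Ints_add Ints_diff diff_add_cancel)
  then show ?thesis using assms by (auto simp: int_lattice_def)
qed

text \<open>The difference along \<open>u k\<close> cuts the condition \<open>0 \<le> l x k\<close>
  down to the half-open unit interval, so after one difference per generator only the box is left.
  Reversing every factor \<open>1 - exp_fps z (u k)\<close> costs the sign
  \<open>(-1) ^ CARD('n)\<close>.\<close>

lemma gen_sum_cone:
  fixes z :: "complex^'n" and u :: "'n \<Rightarrow> real^'n"
  assumes coords: "\<And>x. (\<Sum>k\<in>UNIV. l x k *\<^sub>R u k) = x" "\<And>c. l (\<Sum>k\<in>UNIV. c k *\<^sub>R u k) = c"
    and lat: "\<And>k. u k \<in> int_lattice" and nz: "\<And>k. pairing (u k) z \<noteq> 0"
  shows "gen_sum z (\<lambda>p. of_bool (p \<in> int_lattice \<and> p - b \<in> gcone u UNIV {}))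
    ((-1) ^ CARD('n) * (fps_X ^ CARD('n) / (\<Prod>k\<in>UNIV. exp_fps z (u k) - 1)) *
      (\<Sum>p | p \<in> int_lattice \<and> p - b \<in> half_open_box u. exp_fps z p))"
proof -
  let ?f = "\<lambda>p. of_bool (p \<in> int_lattice \<and> p - b \<in> gcone u UNIV {}) :: complex"
  have l_shift: "l (x - u k) = (l x)(k := l x k - 1)" for x k
  proof -
    have "(\<Sum>j\<in>UNIV. ((l x)(k := l x k - 1)) j *\<^sub>R u j)
        = (\<Sum>j\<in>UNIV. l x j *\<^sub>R u j - (if j = k then u j else 0))"
      by (intro sum.cong) (auto simp: algebra_simps)
    also have "\<dots> = x - u k" by (simp add: sum_subtractf coords)
    finally show ?thesis using coords(2) by metis
  qed
  have cone: "x \<in> gcone u UNIV {} \<longleftrightarrow> (\<forall>k. 0 \<le> l x k)" for x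
  proof
    assume "x \<in> gcone u UNIV {}"
    then show "\<forall>k. 0 \<le> l x k" by (auto simp: gcone_def coords)
  next
    assume "\<forall>k. 0 \<le> l x k"
    then show "x \<in> gcone u UNIV {}"
      unfolding gcone_def using coords(1)[of x] by (intro CollectI exI[of _ "l x"]) auto
  qed
  have box: "x \<in> half_open_box u \<longleftrightarrow> (\<forall>k. 0 \<le> l x k \<and> l x k < 1)" for x
  proof
    assume "x \<in> half_open_box u"
    then show "\<forall>k. 0 \<le> l x k \<and> l x k < 1" by (auto simp: half_open_box_def coords)
  next
    assume "\<forall>k. 0 \<le> l x k \<and> l x k < 1"
    then show "x \<in> half_open_box u"
      unfolding half_open_box_def using coords(1)[of x] by (intro CollectI exI[of _ "l x"]) auto
  qed
  have diffs: "ldiffs (map u ks) ?f = (\<lambda>p. of_bool (p \<in> int_lattice \<and>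
      (\<forall>k. 0 \<le> l (p - b) k \<and> (k \<in> set ks \<longrightarrow> l (p - b) k < 1))))" if "distinct ks" for ks
    using that
  proof (induction ks)
    case Nil
    then show ?case by (simp add: cone)
  next
    case (Cons k ks)
    then have d: "distinct ks" by simp
    show ?case
    proof
      fix p
      let ?x = "p - b"
      have "p - u k - b = ?x - u k" by simp
      then have s: "l (p - u k - b) = (l ?x)(k := l ?x k - 1)" using l_shift by metis
      \<comment> \<open>\<open>A\<close> holds the conditions on the other coordinates, which the
        shift along \<open>u k\<close> leaves alone. As \<open>k\<close> is not in
        \<open>ks\<close>, coordinate \<open>k\<close> has only a lower bound so far, and
        subtracting the condition \<open>1 \<le> l ?x k\<close> from \<open>0 \<le> l ?x k\<close>
        adds the upper one.\<close>
      define A where "A \<longleftrightarrow> (\<forall>j. j \<noteq> k \<longrightarrow> 0 \<le> l ?x j \<and> (j \<in> set ks \<longrightarrow> l ?x j < 1))"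
      have 1: "(\<forall>j. 0 \<le> l ?x j \<and> (j \<in> set ks \<longrightarrow> l ?x j < 1)) \<longleftrightarrow> A \<and> 0 \<le> l ?x k"
        using Cons.prems unfolding A_def by (metis distinct.simps(2))
      have 2: "(\<forall>j. 0 \<le> l (p - u k - b) j \<and> (j \<in> set ks \<longrightarrow> l (p - u k - b) j < 1)) \<longleftrightarrow> A \<and> 1 \<le> l ?x k"
        using Cons.prems unfolding A_def s by auto
      have 3: "(\<forall>j. 0 \<le> l ?x j \<and> (j \<in> set (k # ks) \<longrightarrow> l ?x j < 1)) \<longleftrightarrow> A \<and> 0 \<le> l ?x k \<and> l ?x k < 1"
        using Cons.prems unfolding A_def by auto
      show "ldiffs (map u (k # ks)) ?f p = of_bool (p \<in> int_lattice \<and>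
          (\<forall>j. 0 \<le> l ?x j \<and> (j \<in> set (k # ks) \<longrightarrow> l ?x j < 1)))"
        unfolding 3 list.map foldr_Cons comp_apply Cons.IH[OF d]
        by (auto simp: ldiff_def 1 2 int_lattice_diff lat)
    qed
  qed
  obtain ks where ks: "set ks = (UNIV :: 'n set)" "distinct ks"
    using finite_distinct_list[of "UNIV :: 'n set"] by auto
  define B where "B = {p. p \<in> int_lattice \<and> p - b \<in> half_open_box u}"
  have D: "ldiffs (map u ks) ?f = (\<lambda>p. of_bool (p \<in> B))"
    unfolding diffs[OF ks(2)] using ks(1) by (auto simp: B_def box)
  have "B = (\<lambda>x. x + b) ` half_open_box u \<inter> int_lattice"
    by (auto simp: B_def image_iff) (metis diff_add_cancel)
  moreover have "bounded ((\<lambda>x. x + b) ` half_open_box u)"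
    using bounded_translation[OF bounded_half_open_box, of b] by (simp add: add.commute)
  ultimately have finB: "finite B" using finite_bounded_int_lattice by metis
  have sB: "lat_sum z (\<lambda>p. of_bool (p \<in> B)) = (\<Sum>p\<in>B. exp_fps z p)"
  proof -
    have "lat_sum z (\<lambda>p. of_bool (p \<in> B)) = (\<Sum>p\<in>B. fps_const (of_bool (p \<in> B)) * exp_fps z p)"
      using finB by (intro lat_sum_superset) auto
    also have "\<dots> = (\<Sum>p\<in>B. exp_fps z p)" by (intro sum.cong) auto
    finally show ?thesis .
  qed
  let ?G = "\<Prod>k\<in>UNIV. exp_fps z (u k) - 1"
  have nz': "exp_fps z (u k) - 1 \<noteq> 0" for k using exp_fps_neq_1[OF nz[of k]] by auto
  have sd: "subdegree (exp_fps z (u k) - 1) = 1" for k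
    using nz[of k] by (intro subdegreeI) (auto simp: exp_fps_def)
  have sG: "subdegree ?G = CARD('n)"
    using nz' sd by (subst subdegree_prod) auto
  have G0: "?G \<noteq> 0" using nz' by simp
  \<comment> \<open>The divisor has the same subdegree as \<open>fps_X ^ CARD('n)\<close>, so the
    division is exact.\<close>
  have div: "fps_X ^ CARD('n) / ?G * ?G = fps_X ^ CARD('n)"
    using sG G0 by (intro fps_times_divide_eq) auto
  have "(\<Prod>w\<leftarrow>map u ks. 1 - exp_fps z w) = (\<Prod>k\<in>UNIV. 1 - exp_fps z (u k))"
    using ks prod.distinct_set_conv_list[OF ks(2), of "\<lambda>k. 1 - exp_fps z (u k)"] by (simp add: comp_def)
  also have "\<dots> = (\<Prod>k\<in>UNIV. (-1) * (exp_fps z (u k) - 1))" by simp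
  also have "\<dots> = (-1) ^ CARD('n) * ?G" by (simp only: prod.distrib prod_constant)
  finally have pr: "(\<Prod>w\<leftarrow>map u ks. 1 - exp_fps z w) = (-1) ^ CARD('n) * ?G" .
  have "fps_X ^ CARD('n) * (\<Sum>p\<in>B. exp_fps z p) =
    (((-1) ^ CARD('n) * (-1) ^ CARD('n)) * (fps_X ^ CARD('n) / ?G * ?G)) * (\<Sum>p\<in>B. exp_fps z p)"
    unfolding div by (simp add: power_add[symmetric] mult_2[symmetric])
  also have "\<dots> = ((-1) ^ CARD('n) * ?G) * ((-1) ^ CARD('n) * (fps_X ^ CARD('n) / ?G) * (\<Sum>p\<in>B. exp_fps z p))"
    by (simp only: mult_ac)
  finally have eq: "fps_X ^ CARD('n) * (\<Sum>p\<in>B. exp_fps z p) =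
    ((-1) ^ CARD('n) * ?G) * ((-1) ^ CARD('n) * (fps_X ^ CARD('n) / ?G) * (\<Sum>p\<in>B. exp_fps z p))" .
  show ?thesis
    unfolding gen_sum_def B_def[symmetric]
    by (intro exI[of _ "map u ks"]) (unfold D pr sB eq, use nz finB in auto)
qed

section \<open>Brion's formula and the power sums\<close>

lemma barnes_divisor:
  fixes a :: "complex^'n"
  assumes "\<And>j. a $ j \<noteq> 0"
  shows "subdegree (\<Prod>j\<in>UNIV. fps_exp (a $ j) - 1) = CARD('n)"
proof -
  have "subdegree (fps_exp (a $ j) - 1) = 1" for j
    using assms[of j] by (intro subdegreeI) auto
  moreover have "fps_exp (a $ j) - 1 \<noteq> 0" for j
  proof
    assume "fps_exp (a $ j) - 1 = 0"
    then have "fps_nth (fps_exp (a $ j) - 1) 1 = 0" by simp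
    then show False using assms[of j] by simp
  qed
  ultimately show ?thesis by (subst subdegree_prod) auto
qed

text \<open>Since \<open>fps_X ^ CARD('n)\<close> alone already has the subdegree of the divisor,
  the exponential can be pulled out of the quotient, leaving a factor independent of \<tau>.\<close>

lemma barnes_poly_fps:
  fixes a :: "complex^'n"
  assumes "\<And>j. a $ j \<noteq> 0"
  shows "fps_nth (fps_X ^ CARD('n) / (\<Prod>j\<in>UNIV. fps_exp (a $ j) - 1) * fps_exp \<tau>) k = barnes_poly k \<tau> a / fact k"
  using barnes_divisor[of a] assms by (simp add: barnes_poly_def fps_divide_times2)

lemma barnes_poly_expansion:
  fixes a :: "complex^'n"
  assumes "\<And>j. a $ j \<noteq> 0"
  shows "barnes_poly k \<tau> a / fact k = (\<Sum>j\<le>k. barnes_number j a / fact j * (\<tau> ^ (k - j) / fact (k - j)))"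
proof -
  let ?B = "fps_X ^ CARD('n) / (\<Prod>j\<in>UNIV. fps_exp (a $ j) - 1)"
  have "fps_nth ?B j = barnes_number j a / fact j" for j
    using barnes_poly_fps[OF assms, of 0 j] by (simp add: barnes_number_def)
  then show ?thesis
    unfolding barnes_poly_fps[OF assms, symmetric] fps_mult_nth
    by (simp add: atMost_atLeast0)
qed

context numbered_polytope
begin

lemma generic_pairing_nonzero: "generic P w z \<Longrightarrow> v \<in> vertices P \<Longrightarrow> pairing (w v k) z \<noteq> 0"
  unfolding generic_def by (metis mult_zero_right of_int_0)

lemma finite_lattice_points: "finite ((\<lambda>x. t *\<^sub>R x) ` P \<inter> int_lattice)"
  by (intro finite_bounded_int_lattice bounded_scaling polytope_imp_bounded polytope)

text \<open>The indicator of the dilated polytope on the lattice has finite support, so its formal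
  sum is the actual exponential sum. By the decomposition it is also the sum of the vertex cone
  series, the remaining terms being periodic along an edge. Uniqueness equates the two
  values.\<close>

lemma brion_formula:
  fixes z :: "complex^'n"
  assumes "t > 0" "generic P w z"
  shows "fps_X ^ CARD('n) * (\<Sum>p\<in>(\<lambda>x. t *\<^sub>R x) ` P \<inter> int_lattice. exp_fps z p) =
    (\<Sum>v\<in>vertices P. (-1) ^ CARD('n) * (fps_X ^ CARD('n) / (\<Prod>k\<in>UNIV. exp_fps z (w v k) - 1)) *
      (\<Sum>p | p \<in> int_lattice \<and> p - t *\<^sub>R v \<in> half_open_box (w v). exp_fps z p))"
    (is "_ * ?S = (\<Sum>v\<in>_. ?\<sigma> v)")
proof -
  define f where "f p = (of_bool (p \<in> (\<lambda>x. t *\<^sub>R x) ` P \<inter> int_lattice) :: complex)" for p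
  define g where "g v p = (of_bool (p \<in> int_lattice \<and> p - t *\<^sub>R v \<in> gcone (w v) UNIV {}) :: complex)" for v p
  define h where "h F p = (of_bool (p \<in> int_lattice \<and> ((1 / t) *\<^sub>R p, 1) \<in> face_cone F) :: complex)" for F p
  let ?\<F> = "{F. F \<subseteq> vertices P \<and> 2 \<le> card F}"
  have of_bool: "complex_of_real (of_bool Q) = of_bool Q" for Q by (cases Q) auto
  have f: "f p = (\<Sum>v\<in>vertices P. g v p) + (\<Sum>F\<in>?\<F>. (- ((-1) ^ card F)) * h F p)" for p
  proof (cases "p \<in> int_lattice")
    case True
    have "f p = of_real (of_bool (p \<in> (\<lambda>x. t *\<^sub>R x) ` P))" using True by (simp add: f_def)
    also have "\<dots> = (\<Sum>v\<in>vertices P. g v p) + (\<Sum>F\<in>?\<F>. (- ((-1) ^ card F)) * h F p)"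
      unfolding indicator_decomposition[OF assms(1)]
      using True by (simp add: g_def h_def sum_negf of_bool)
    finally show ?thesis .
  qed (simp add: f_def g_def h_def)
  have "{p. f p \<noteq> 0} = (\<lambda>x. t *\<^sub>R x) ` P \<inter> int_lattice" by (auto simp: f_def)
  then have "finite {p. f p \<noteq> 0}" "lat_sum z f = ?S"
    using finite_lattice_points by (auto simp: lat_sum_def f_def intro!: sum.cong)
  then have "gen_sum z f (fps_X ^ CARD('n) * ?S)"
    using gen_sum_finite[of f z] by simp
  moreover have "gen_sum z f ((\<Sum>v\<in>vertices P. ?\<sigma> v) + (\<Sum>F\<in>?\<F>. fps_const (- ((-1) ^ card F)) * 0))"
    unfolding f
  proof (intro gen_sum_add gen_sum_sum gen_sum_cmult)
    fix v assume v: "v \<in> vertices P"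
    obtain l where "\<And>x. (\<Sum>k\<in>UNIV. l x k *\<^sub>R w v k) = x" "\<And>c. l (\<Sum>k\<in>UNIV. c k *\<^sub>R w v k) = c"
      by (rule basis_coordinates[OF edge_vec_basis[OF v]]) blast
    then show "gen_sum z (g v) (?\<sigma> v)"
      unfolding g_def using edge_vec(1)[OF v] generic_pairing_nonzero[OF assms(2) v]
      by (rule gen_sum_cone)
  next
    fix F assume "F \<in> ?\<F>"
    then obtain v k where v: "v \<in> vertices P"
      and k: "\<And>c y. y + (c *\<^sub>R w v k, 0) \<in> face_cone F \<longleftrightarrow> y \<in> face_cone F"
      using face_cone_line[of F] by blast
    \<comment> \<open>The cone is tested at \<open>(1 / t) *\<^sub>R p\<close>, so shifting
      \<open>p\<close> by the edge vector shifts the tested point by the multiple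
      \<open>- (1 / t)\<close>.\<close>
    have "h F (p - w v k) = h F p" for p
      using k[of "((1 / t) *\<^sub>R p, 1)" "- (1 / t)"] int_lattice_diff[OF edge_vec(1)[OF v]]
      by (simp add: h_def scaleR_diff_right)
    then show "gen_sum z (h F) 0"
      using generic_pairing_nonzero[OF assms(2) v] by (intro gen_sum_periodic) auto
  qed
  ultimately have "fps_X ^ CARD('n) * ?S = (\<Sum>v\<in>vertices P. ?\<sigma> v) + (\<Sum>F\<in>?\<F>. fps_const (- ((-1) ^ card F)) * 0)"
    by (rule gen_sum_unique)
  then show ?thesis by simp
qed

text \<open>Compares coefficients of degree \<open>d + m\<close> in Brion's formula. On the left
  \<open>fps_X ^ CARD('n)\<close> leaves the coefficient of degree \<open>m\<close>, the power sum
  over \<open>fact m\<close>; on the right each vertex gives a Cauchy product of a Barnes series and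
  a box series.\<close>

lemma power_sum_formula:
  fixes z :: "complex^'n"
  assumes "t > 0" "generic P w z"
  shows "power_sum P m z t = (-1) ^ CARD('n) * fact m *
    (\<Sum>v\<in>vertices P. \<Sum>k\<le>CARD('n) + m.
      1 / (fact k * fact (CARD('n) + m - k))
      * barnes_poly k (of_real t * pairing v z) (edge_values (w v) z)
      * (\<Sum>q\<in>box_points (w v) t v. pairing q z ^ (CARD('n) + m - k)))"
proof -
  let ?D = "CARD('n) + m"
  have vertex_term: "fps_nth ((-1) ^ CARD('n) * (fps_X ^ CARD('n) / (\<Prod>k\<in>UNIV. exp_fps z (w v k) - 1)) *
      (\<Sum>p | p \<in> int_lattice \<and> p - t *\<^sub>R v \<in> half_open_box (w v). exp_fps z p)) ?D =
    (-1) ^ CARD('n) * (\<Sum>k\<le>?D. 1 / (fact k * fact (?D - k))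
      * barnes_poly k (of_real t * pairing v z) (edge_values (w v) z)
      * (\<Sum>q\<in>box_points (w v) t v. pairing q z ^ (?D - k)))" if v: "v \<in> vertices P" for v
  proof -
    let ?a = "edge_values (w v) z" and ?\<tau> = "of_real t * pairing v z"
    let ?B = "fps_X ^ CARD('n) / (\<Prod>j\<in>UNIV. fps_exp (?a $ j) - 1)"
    have a: "?a $ j \<noteq> 0" for j
      using generic_pairing_nonzero[OF assms(2) v] by (simp add: edge_values_def)
    have B: "fps_X ^ CARD('n) / (\<Prod>k\<in>UNIV. exp_fps z (w v k) - 1) = ?B"
      by (simp add: exp_fps_def edge_values_def)
    \<comment> \<open>Substituting \<open>p = t *\<^sub>R v + q\<close> splits off an exponential
      factor, which supplies the argument of the Barnes polynomial.\<close>
    have "(\<Sum>p | p \<in> int_lattice \<and> p - t *\<^sub>R v \<in> half_open_box (w v). exp_fps z p)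
        = (\<Sum>q\<in>box_points (w v) t v. exp_fps z (t *\<^sub>R v + q))"
      by (rule sum.reindex_bij_witness[of _ "\<lambda>q. t *\<^sub>R v + q" "\<lambda>p. p - t *\<^sub>R v"])
        (auto simp: box_points_def)
    also have "\<dots> = fps_exp ?\<tau> * (\<Sum>q\<in>box_points (w v) t v. exp_fps z q)"
      unfolding exp_fps_def by (simp add: sum_distrib_left pairing_add pairing_scale fps_exp_add_mult)
    finally have "fps_nth ((-1) ^ CARD('n) * (fps_X ^ CARD('n) / (\<Prod>k\<in>UNIV. exp_fps z (w v k) - 1)) *
      (\<Sum>p | p \<in> int_lattice \<and> p - t *\<^sub>R v \<in> half_open_box (w v). exp_fps z p)) ?D
      = fps_nth (fps_const ((-1) ^ CARD('n)) * ((?B * fps_exp ?\<tau>) * (\<Sum>q\<in>box_points (w v) t v. exp_fps z q))) ?D"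
      unfolding B by (simp add: mult.assoc fps_const_power[symmetric] fps_const_neg[symmetric]
          del: fps_const_power fps_const_neg)
    also have "\<dots> = (-1) ^ CARD('n) * (\<Sum>k=0..?D. fps_nth (?B * fps_exp ?\<tau>) k *
        (\<Sum>q\<in>box_points (w v) t v. pairing q z ^ (?D - k) / fact (?D - k)))"
      by (simp add: fps_mult_nth[of "_ * _" "sum _ _"] fps_sum_nth exp_fps_def)
    also have "\<dots> = (-1) ^ CARD('n) * (\<Sum>k\<le>?D. 1 / (fact k * fact (?D - k))
      * barnes_poly k ?\<tau> ?a * (\<Sum>q\<in>box_points (w v) t v. pairing q z ^ (?D - k)))"
      unfolding barnes_poly_fps[of ?a, OF a]
      by (simp add: atMost_atLeast0 sum_divide_distrib[symmetric] mult_ac)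
    finally show ?thesis .
  qed
  have "power_sum P m z t / fact m =
      fps_nth (fps_X ^ CARD('n) * (\<Sum>p\<in>(\<lambda>x. t *\<^sub>R x) ` P \<inter> int_lattice. exp_fps z p)) ?D"
    by (simp add: power_sum_def fps_X_power_mult_nth fps_sum_nth exp_fps_def sum_divide_distrib)
  also have "\<dots> = (\<Sum>v\<in>vertices P. (-1) ^ CARD('n) * (\<Sum>k\<le>?D. 1 / (fact k * fact (?D - k))
      * barnes_poly k (of_real t * pairing v z) (edge_values (w v) z)
      * (\<Sum>q\<in>box_points (w v) t v. pairing q z ^ (?D - k))))"
    unfolding brion_formula[OF assms] fps_sum_nth by (intro sum.cong refl vertex_term)
  finally show ?thesis by (simp add: sum_distrib_left[symmetric] field_simps)
qed

section \<open>The power sum as a polynomial with periodic coefficients\<close>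

definition quasi_coeff :: "nat \<Rightarrow> complex^'n \<Rightarrow> nat \<Rightarrow> real \<Rightarrow> complex"
  where "quasi_coeff m z r t = (-1) ^ CARD('n) * fact m / fact (CARD('n) + m) *
    (\<Sum>v\<in>vertices P. \<Sum>j\<le>CARD('n) + m - r.
      trinomial (CARD('n) + m) r j * barnes_number j (edge_values (w v) z) * pairing v z ^ r
      * (\<Sum>q\<in>box_points (w v) t v. pairing q z ^ (CARD('n) + m - r - j)))"

text \<open>Expanding each Barnes polynomial in Barnes numbers and writing \<open>k = j + r\<close>
  turns the triangular sum over \<open>k\<close> and \<open>j\<close> into one over the exponent
  \<open>r\<close> of \<open>t\<close>.\<close>

lemma power_sum_quasi_coeff:
  assumes "t > 0" "generic P w z"
  shows "power_sum P m z t = (\<Sum>r\<le>CARD('n) + m. quasi_coeff m z r t * of_real t ^ r)"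
proof -
  let ?D = "CARD('n) + m"
  have v: "(\<Sum>k\<le>?D. 1 / (fact k * fact (?D - k))
      * barnes_poly k (of_real t * pairing v z) (edge_values (w v) z)
      * (\<Sum>q\<in>box_points (w v) t v. pairing q z ^ (?D - k))) =
    (\<Sum>r\<le>?D. of_real t ^ r / fact ?D * (\<Sum>j\<le>?D - r.
      trinomial ?D r j * barnes_number j (edge_values (w v) z) * pairing v z ^ r
      * (\<Sum>q\<in>box_points (w v) t v. pairing q z ^ (?D - r - j))))" if v: "v \<in> vertices P" for v
  proof -
    let ?a = "edge_values (w v) z" and ?\<tau> = "of_real t * pairing v z"
    define S where "S i = (\<Sum>q\<in>box_points (w v) t v. pairing q z ^ i)" for i
    define g where "g r j = barnes_number j ?a / fact j * (?\<tau> ^ r / fact r) * (S (?D - r - j) / fact (?D - r - j))"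
      for r j
    have a: "?a $ j \<noteq> 0" for j
      using generic_pairing_nonzero[OF assms(2) v] by (simp add: edge_values_def)
    have "(\<Sum>k\<le>?D. 1 / (fact k * fact (?D - k)) * barnes_poly k ?\<tau> ?a * S (?D - k)) =
        (\<Sum>k\<le>?D. (barnes_poly k ?\<tau> ?a / fact k) * (S (?D - k) / fact (?D - k)))"
      by (simp add: field_simps)
    also have "\<dots> = (\<Sum>k\<le>?D. \<Sum>j\<le>k. g (k - j) j)"
      unfolding barnes_poly_expansion[of ?a, OF a] sum_distrib_right by (auto simp: g_def intro!: sum.cong)
    also have "\<dots> = (\<Sum>(j, r)\<in>{(j, r). j + r \<le> ?D}. g r j)"
      by (rule sum.triangle_reindex_eq[symmetric])
    also have "\<dots> = (\<Sum>(r, j)\<in>Sigma {..?D} (\<lambda>r. {..?D - r}). g r j)"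
      by (rule sum.reindex_bij_witness[of _ "\<lambda>(r, j). (j, r)" "\<lambda>(j, r). (r, j)"]) auto
    also have "\<dots> = (\<Sum>r\<le>?D. \<Sum>j\<le>?D - r. g r j)"
      by (subst sum.Sigma) auto
    also have "\<dots> = (\<Sum>r\<le>?D. of_real t ^ r / fact ?D * (\<Sum>j\<le>?D - r.
        trinomial ?D r j * barnes_number j ?a * pairing v z ^ r * S (?D - r - j)))"
      unfolding sum_distrib_left
      by (intro sum.cong refl) (simp add: g_def trinomial_def power_mult_distrib mult_ac)
    finally show ?thesis unfolding S_def .
  qed
  have "power_sum P m z t = (-1) ^ CARD('n) * fact m * (\<Sum>v\<in>vertices P.
    (\<Sum>r\<le>?D. of_real t ^ r / fact ?D * (\<Sum>j\<le>?D - r.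
      trinomial ?D r j * barnes_number j (edge_values (w v) z) * pairing v z ^ r
      * (\<Sum>q\<in>box_points (w v) t v. pairing q z ^ (?D - r - j)))))"
    unfolding power_sum_formula[OF assms] by (intro arg_cong2[of _ _ _ _ "(*)"] sum.cong refl v)
  also have "\<dots> = (\<Sum>r\<le>?D. quasi_coeff m z r t * of_real t ^ r)"
    by (subst sum.swap) (simp add: quasi_coeff_def sum_distrib_left sum_distrib_right mult_ac)
  finally show ?thesis .
qed

text \<open>For a common denominator \<open>N\<close> of all vertex coordinates,
  \<open>N *\<^sub>R v\<close> is a lattice vector, so adding \<open>N\<close> to \<open>t\<close>
  moves the translated lattice onto itself.\<close>

lemma box_points_periodic:
  "\<exists>N>0. \<forall>v\<in>vertices P. \<forall>t. box_points (w v) (t + N) v = box_points (w v) t v"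
proof -
  let ?S = "(\<lambda>(v, i). v $ i) ` (vertices P \<times> UNIV)"
  have "finite ?S" "?S \<subseteq> \<rat>"
    using finite_vertices rational by (auto simp: rational_polytope_def)
  then obtain N :: nat where N: "N > 0" "\<forall>q\<in>?S. real N * q \<in> \<int>" using common_denominator by metis
  have "box_points (w v) (t + real N) v = box_points (w v) t v" if v: "v \<in> vertices P" for v t
  proof -
    have lat: "real N *\<^sub>R v \<in> int_lattice" using N(2) v by (auto simp: int_lattice_def)
    have mem: "q \<in> (\<lambda>p. p - s *\<^sub>R v) ` int_lattice \<longleftrightarrow> q + s *\<^sub>R v \<in> int_lattice" for q s
      by (auto simp: image_iff) (metis add_diff_cancel_right')
    have "q + (t + real N) *\<^sub>R v \<in> int_lattice \<longleftrightarrow> q + t *\<^sub>R v \<in> int_lattice" for q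
      using int_lattice_diff[OF lat, of "q + (t + real N) *\<^sub>R v"] by (simp add: scaleR_add_left add.assoc[symmetric])
    then show ?thesis unfolding box_points_def set_eq_iff Int_iff mem by simp
  qed
  then show ?thesis using N(1) by (intro exI[of _ "real N"]) auto
qed

lemma quasi_poly_coeffs_exist:
  assumes "generic P w z"
  shows "quasi_poly_coeffs (CARD('n) + m) (power_sum P m z)
    (\<lambda>r t. if r \<le> CARD('n) + m then quasi_coeff m z r t else 0)"
proof -
  obtain N where "N > 0" "\<forall>v\<in>vertices P. \<forall>t. box_points (w v) (t + N) v = box_points (w v) t v"
    using box_points_periodic by auto
  then have "N > 0" "quasi_coeff m z r (t + N) = quasi_coeff m z r t" for r t
    by (auto simp: quasi_coeff_def)
  then show ?thesis
    unfolding quasi_poly_coeffs_def using power_sum_quasi_coeff[OF _ assms, of _ m]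
    by (intro conjI exI[of _ N]) auto
qed

end

section \<open>Quasi-polynomials that are step functions\<close>

abbreviation shift_poly :: "complex poly \<Rightarrow> real \<Rightarrow> complex poly"
  where "shift_poly p t \<equiv> pcompose p [:- of_real t, 1:]"

text \<open>Coefficientwise form of the chain rule: the derivative of \<open>p (X - t)\<close> in
  \<open>t\<close> is minus \<open>p'\<close> at \<open>X - t\<close>. The induction follows
  Horner's scheme.\<close>

lemma shift_poly_coeff_derivative:
  "((\<lambda>t. poly.coeff (shift_poly p t) r) has_vector_derivative
    - (of_nat (r + 1) * poly.coeff (shift_poly p t) (r + 1))) (at t within S)"
proof (induction p arbitrary: r)
  case (pCons a p)
  let ?h = "\<lambda>t. poly.coeff (shift_poly p t)"
  show ?case
  proof (cases r)
    case 0
    have "((\<lambda>t. a + of_real (- t) * ?h t 0) has_vector_derivative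
        0 + (of_real (- t) * (- (of_nat (0 + 1) * ?h t (0 + 1))) + of_real (- 1) * ?h t 0)) (at t within S)"
      by (intro derivative_intros has_vector_derivative_mult has_vector_derivative_of_real pCons.IH)
    then show ?thesis using 0
      by (simp add: pcompose_pCons coeff_pCons algebra_simps)
  next
    case (Suc r')
    have "((\<lambda>t. of_real (- t) * ?h t (Suc r') + ?h t r') has_vector_derivative
        (of_real (- t) * (- (of_nat (Suc r' + 1) * ?h t (Suc r' + 1))) + of_real (- 1) * ?h t (Suc r'))
        + (- (of_nat (r' + 1) * ?h t (r' + 1)))) (at t within S)"
      by (intro derivative_intros has_vector_derivative_mult has_vector_derivative_of_real
          has_vector_derivative_add pCons.IH)
    then show ?thesis using Suc
      by (simp add: pcompose_pCons coeff_pCons algebra_simps)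
  qed
qed simp

lemma shift_poly_coeff_degree: "degree p < r \<Longrightarrow> poly.coeff (shift_poly p t) r = 0"
  by (intro coeff_eq_0) (use degree_pcompose_le[of p "[:- of_real t, 1:]"] in simp)

lemma lagrange_basis:
  fixes x :: "nat \<Rightarrow> 'a::field"
  assumes "inj_on x {..n}"
  obtains l where "\<And>i. i \<le> n \<Longrightarrow> degree (l i) \<le> n"
    "\<And>i k. i \<le> n \<Longrightarrow> k \<le> n \<Longrightarrow> poly (l i) (x k) = of_bool (k = i)"
proof -
  define q where "q i = (\<Prod>j\<in>{..n} - {i}. [:- x j, 1:])" for i
  define l where "l i = smult (1 / poly (q i) (x i)) (q i)" for i
  have "degree (l i) \<le> n" if "i \<le> n" for i
  proof -
    have "degree (q i) \<le> sum (degree \<circ> (\<lambda>j. [:- x j, 1:])) ({..n} - {i})"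
      unfolding q_def by (rule degree_prod_sum_le) simp
    also have "\<dots> = n" using that by simp
    finally show ?thesis unfolding l_def using degree_smult_le le_trans by blast
  qed
  moreover have "poly (l i) (x k) = of_bool (k = i)" if "i \<le> n" "k \<le> n" for i k
  proof (cases "k = i")
    case True
    have "poly (q i) (x i) \<noteq> 0"
      using assms that by (auto simp: q_def poly_prod inj_on_def)
    then show ?thesis using True by (simp add: l_def)
  next
    case False
    then have "poly (q i) (x k) = 0"
      unfolding q_def poly_prod using that by (intro prod_zero bexI[of _ k]) auto
    then show ?thesis using False by (simp add: l_def)
  qed
  ultimately show ?thesis using that by blast
qed

lemma periodic_multiple:
  fixes c :: "real \<Rightarrow> 'a"
  assumes "\<forall>t>0. c (t + T) = c t" "0 < T" "0 < t"
  shows "c (t + real k * T) = c t"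
proof (induction k)
  case (Suc k)
  have "c ((t + real k * T) + T) = c (t + real k * T)"
    using assms by (intro assms(1)[rule_format] add_pos_nonneg) auto
  then show ?case using Suc by (simp add: algebra_simps)
qed simp

text \<open>The common period freezes the coefficients along \<open>t + k T\<close>, so the values
  of \<open>f\<close> there come from a single polynomial of degree at most \<open>n\<close>. The
  Lagrange basis \<open>l\<close> belongs to the nodes \<open>k T\<close> and does not depend on
  \<open>t\<close>, which leaves \<open>t\<close> only in the samples and in the shift.\<close>

lemma quasi_poly_coeffs_interpolation:
  assumes "quasi_poly_coeffs n f c"
  obtains T l where "T > 0" "\<And>r t. t > 0 \<Longrightarrow> c r (t + T) = c r t"
    "\<And>r t. t > 0 \<Longrightarrow> c r t = (\<Sum>k\<le>n. f (t + real k * T) * poly.coeff (shift_poly (l k) t) r)"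
proof -
  obtain T where T: "T > 0" "\<And>r t. r \<le> n \<Longrightarrow> t > 0 \<Longrightarrow> c r (t + T) = c r t"
    and c0: "\<And>r t. r > n \<Longrightarrow> t > 0 \<Longrightarrow> c r t = 0"
    and f: "\<And>t. t > 0 \<Longrightarrow> f t = (\<Sum>r\<le>n. c r t * of_real t ^ r)"
    using assms by (auto simp: quasi_poly_coeffs_def)
  define x where "x k = complex_of_real (real k * T)" for k
  have inj: "inj_on x A" for A
    using T(1) by (auto simp: inj_on_def x_def)
  obtain l where l: "\<And>i. i \<le> n \<Longrightarrow> degree (l i) \<le> n"
    "\<And>i k. i \<le> n \<Longrightarrow> k \<le> n \<Longrightarrow> poly (l i) (x k) = of_bool (k = i)"
    using lagrange_basis[OF inj] by metis
  have per: "c r (t + T) = c r t" if "t > 0" for r t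
    using T c0[of r] that by (cases "r \<le> n") auto
  have "c r t = (\<Sum>k\<le>n. f (t + real k * T) * poly.coeff (shift_poly (l k) t) r)" if t: "t > 0" for r t
  proof (cases "r \<le> n")
    case True
    \<comment> \<open>\<open>R\<close> has the coefficients frozen at \<open>t\<close>;
      \<open>Q\<close> recentres it, so that the sampling points become the nodes
      \<open>x k\<close>.\<close>
    define R where "R = (\<Sum>r\<le>n. monom (c r t) r)"
    define Q where "Q = pcompose R [:of_real t, 1:]"
    have degR: "degree R \<le> n"
      unfolding R_def by (intro degree_sum_le) (auto intro: order.trans[OF degree_monom_le])
    then have degQ: "degree Q \<le> n"
      unfolding Q_def using degree_pcompose_le[of R "[:of_real t, 1:]"] by simp
    have pQ: "poly Q (x k) = f (t + real k * T)" for k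
    proof -
      have "t + real k * T > 0" using t T(1) by (intro add_pos_nonneg) auto
      then have "f (t + real k * T) = (\<Sum>r\<le>n. c r t * of_real (t + real k * T) ^ r)"
        using periodic_multiple[of "c _" T t k] per T(1) t by (simp add: f)
      also have "\<dots> = poly Q (x k)"
        by (simp add: Q_def R_def poly_pcompose poly_sum poly_monom x_def)
      finally show ?thesis ..
    qed
    define L where "L = (\<Sum>k\<le>n. smult (f (t + real k * T)) (l k))"
    have degL: "degree L \<le> n"
      unfolding L_def using l(1) by (intro degree_sum_le) (auto intro: order.trans[OF degree_smult_le])
    have "Q = L"
    proof (rule poly_eqI_degree[of "x ` {..n}"])
      fix y assume "y \<in> x ` {..n}"
      then obtain k where k: "k \<le> n" "y = x k" by auto
      have "poly L y = (\<Sum>i\<le>n. if k = i then f (t + real i * T) else 0)"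
        unfolding L_def poly_sum k(2) using k(1) l(2) by (intro sum.cong) auto
      then show "poly Q y = poly L y" using k by (simp add: pQ)
    qed (use degQ degL inj in \<open>auto simp: card_image\<close>)
    have "shift_poly Q t = pcompose R [:0, 1:]"
      unfolding Q_def by (subst pcompose_assoc[symmetric]) (simp add: pcompose_pCons)
    then have "R = shift_poly L t" using \<open>Q = L\<close> by (simp add: pcompose_idR)
    then have "poly.coeff R r = (\<Sum>k\<le>n. f (t + real k * T) * poly.coeff (shift_poly (l k) t) r)"
      by (simp add: L_def pcompose_sum pcompose_smult coeff_sum)
    moreover have "poly.coeff R r = c r t"
      using True by (simp add: R_def coeff_sum)
    ultimately show ?thesis by simp
  next
    case False
    then have "poly.coeff (shift_poly (l k) t) r = 0" if "k \<le> n" for k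
      using l(1)[OF that] by (intro shift_poly_coeff_degree) simp
    then show ?thesis using False t by (simp add: c0)
  qed
  then show ?thesis using that T(1) per by blast
qed

text \<open>Boundedness on bounded ranges serves uniqueness, constancy on each side of a point the
  derivative, and finiteness of the jumps the count of discontinuities.\<close>

definition step_function :: "(real \<Rightarrow> complex) \<Rightarrow> bool"
  where "step_function f \<longleftrightarrow>
    (\<forall>b. \<exists>K. \<forall>t. 0 < t \<and> t \<le> b \<longrightarrow> norm (f t) \<le> K) \<and>
    (\<forall>t>0. \<exists>u. \<forall>\<^sub>F s in at_right t. f s = u) \<and>
    (\<forall>t>0. \<exists>u. \<forall>\<^sub>F s in at_left t. f s = u) \<and>
    (\<forall>b. finite {t. 0 < t \<and> t \<le> b \<and> \<not> (\<forall>\<^sub>F s in nhds t. f s = f t)})"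

section \<open>Closure properties and examples of step functions\<close>

lemma step_function_zero: "step_function (\<lambda>t. 0)"
  by (auto simp: step_function_def)

lemma step_function_add:
  assumes "step_function f" "step_function g"
  shows "step_function (\<lambda>t. f t + g t)"
  unfolding step_function_def
proof (intro conjI allI impI)
  fix b
  obtain K L where "\<And>t. 0 < t \<Longrightarrow> t \<le> b \<Longrightarrow> norm (f t) \<le> K" "\<And>t. 0 < t \<Longrightarrow> t \<le> b \<Longrightarrow> norm (g t) \<le> L"
    using assms unfolding step_function_def by metis
  then show "\<exists>K. \<forall>t. 0 < t \<and> t \<le> b \<longrightarrow> norm (f t + g t) \<le> K"
    by (intro exI[of _ "K + L"] allI impI norm_triangle_mono) auto
  let ?E = "\<lambda>f. {t. 0 < t \<and> t \<le> b \<and> \<not> (\<forall>\<^sub>F s in nhds t. f s = (f t :: complex))}"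
  have "?E (\<lambda>t. f t + g t) \<subseteq> ?E f \<union> ?E g"
  proof
    fix t assume t: "t \<in> ?E (\<lambda>t. f t + g t)"
    have "\<not> ((\<forall>\<^sub>F s in nhds t. f s = f t) \<and> (\<forall>\<^sub>F s in nhds t. g s = g t))"
    proof
      assume "(\<forall>\<^sub>F s in nhds t. f s = f t) \<and> (\<forall>\<^sub>F s in nhds t. g s = g t)"
      then have "\<forall>\<^sub>F s in nhds t. f s = f t \<and> g s = g t" by (simp add: eventually_conj_iff)
      then have "\<forall>\<^sub>F s in nhds t. f s + g s = f t + g t" by eventually_elim auto
      then show False using t by auto
    qed
    then show "t \<in> ?E f \<union> ?E g" using t by auto
  qed
  then show "finite (?E (\<lambda>t. f t + g t))"
    using assms unfolding step_function_def by (meson finite_UnI finite_subset)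
next
  fix t :: real assume "t > 0"
  then obtain u v where "\<forall>\<^sub>F s in at_right t. f s = u" "\<forall>\<^sub>F s in at_right t. g s = v"
    using assms unfolding step_function_def by metis
  then have "\<forall>\<^sub>F s in at_right t. f s + g s = u + v" by eventually_elim auto
  then show "\<exists>u. \<forall>\<^sub>F s in at_right t. f s + g s = u" ..
next
  fix t :: real assume "t > 0"
  then obtain u v where "\<forall>\<^sub>F s in at_left t. f s = u" "\<forall>\<^sub>F s in at_left t. g s = v"
    using assms unfolding step_function_def by metis
  then have "\<forall>\<^sub>F s in at_left t. f s + g s = u + v" by eventually_elim auto
  then show "\<exists>u. \<forall>\<^sub>F s in at_left t. f s + g s = u" ..
qed

lemma step_function_sum: "(\<And>i. i \<in> I \<Longrightarrow> step_function (f i)) \<Longrightarrow> step_function (\<lambda>t. \<Sum>i\<in>I. f i t)"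
  by (induction I rule: infinite_finite_induct) (auto simp: step_function_zero step_function_add)

text \<open>A convex set of reals is an interval, and its indicator can change only at its at most
  two frontier points.\<close>

lemma step_function_interval:
  fixes J :: "real set"
  assumes "convex J"
  shows "step_function (\<lambda>t. of_bool (t \<in> J) * a)"
  unfolding step_function_def
proof (intro conjI allI impI)
  let ?f = "\<lambda>t. of_bool (t \<in> J) * a"
  have J: "x \<in> J" if "y \<in> J" "z \<in> J" "y \<le> x" "x \<le> z" for x y z
    using assms that is_interval_convex_1 mem_is_interval_1_I by metis
  fix b
  show "\<exists>K. \<forall>t. 0 < t \<and> t \<le> b \<longrightarrow> norm (?f t) \<le> K"
    by (intro exI[of _ "norm a"]) auto
  have "\<forall>\<^sub>F s in nhds t. ?f s = ?f t" if "t \<notin> frontier J" for t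
  proof -
    have "t \<in> interior J \<or> t \<in> interior (- J)"
      using that by (auto simp: frontier_def interior_complement)
    then have "(\<forall>\<^sub>F s in nhds t. s \<in> J) \<or> (\<forall>\<^sub>F s in nhds t. s \<notin> J)"
      unfolding eventually_nhds mem_interior by (metis Compl_iff centre_in_ball open_ball subsetD)
    then show ?thesis
    proof
      assume ev: "\<forall>\<^sub>F s in nhds t. s \<in> J"
      then have "t \<in> J" by (rule eventually_nhds_x_imp_x)
      from ev show ?thesis by eventually_elim (use \<open>t \<in> J\<close> in auto)
    next
      assume ev: "\<forall>\<^sub>F s in nhds t. s \<notin> J"
      then have "t \<notin> J" by (rule eventually_nhds_x_imp_x)
      from ev show ?thesis by eventually_elim (use \<open>t \<notin> J\<close> in auto)
    qed
  qed
  then have "{t. 0 < t \<and> t \<le> b \<and> \<not> (\<forall>\<^sub>F s in nhds t. ?f s = ?f t)} \<subseteq> frontier J" by blast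
  moreover have "finite (frontier J)"
  proof -
    obtain a b where "J = {} \<or> J = UNIV \<or> J = {..<b} \<or> J = {..b} \<or> J = {a<..} \<or> J = {a..} \<or>
        J = {a<..<b} \<or> J = {a<..b} \<or> J = {a..<b} \<or> J = {a..b}"
      using interval_cases[of J] J by metis
    moreover have cl: "closure {a<..<b} \<subseteq> {a..b}" "closure {a<..b} \<subseteq> {a..b}" "closure {a..<b} \<subseteq> {a..b}"
      by (intro closure_minimal; auto)+
    ultimately have "frontier J \<subseteq> {a, b}"
      unfolding frontier_def
      by (elim disjE) (auto simp: interior_open split: if_splits dest!: subsetD[OF cl(1)] subsetD[OF cl(2)] subsetD[OF cl(3)])
    then show ?thesis using finite_subset by blast
  qed
  ultimately show "finite {t. 0 < t \<and> t \<le> b \<and> \<not> (\<forall>\<^sub>F s in nhds t. ?f s = ?f t)}"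
    by (rule rev_finite_subset[rotated])
next
  have J: "x \<in> J" if "y \<in> J" "z \<in> J" "y \<le> x" "x \<le> z" for x y z
    using assms that is_interval_convex_1 mem_is_interval_1_I by metis
  let ?f = "\<lambda>t. of_bool (t \<in> J) * a"
  fix t :: real
  have "(\<forall>\<^sub>F s in at_right t. s \<in> J) \<or> (\<forall>\<^sub>F s in at_right t. s \<notin> J)"
  proof (rule disjCI)
    assume "\<not> (\<forall>\<^sub>F s in at_right t. s \<notin> J)"
    then have fr: "\<exists>s\<in>J. t < s \<and> s < y" if "t < y" for y
      using that unfolding eventually_at_right_field by blast
    obtain y where y: "y \<in> J" "t < y" using fr[of "t + 1"] by auto
    have "s \<in> J" if "t < s" "s < y" for s using fr[OF that(1)] y that J by (meson less_imp_le)
    then show "\<forall>\<^sub>F s in at_right t. s \<in> J" using y unfolding eventually_at_right_field by blast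
  qed
  then show "\<exists>u. \<forall>\<^sub>F s in at_right t. ?f s = u"
  proof
    assume "\<forall>\<^sub>F s in at_right t. s \<in> J"
    then have "\<forall>\<^sub>F s in at_right t. ?f s = a" by eventually_elim simp
    then show ?thesis ..
  next
    assume "\<forall>\<^sub>F s in at_right t. s \<notin> J"
    then have "\<forall>\<^sub>F s in at_right t. ?f s = 0" by eventually_elim simp
    then show ?thesis ..
  qed
  have "(\<forall>\<^sub>F s in at_left t. s \<in> J) \<or> (\<forall>\<^sub>F s in at_left t. s \<notin> J)"
  proof (rule disjCI)
    assume "\<not> (\<forall>\<^sub>F s in at_left t. s \<notin> J)"
    then have fr: "\<exists>s\<in>J. y < s \<and> s < t" if "y < t" for y
      using that unfolding eventually_at_left_field by blast
    obtain y where y: "y \<in> J" "y < t" using fr[of "t - 1"] by auto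
    have "s \<in> J" if "y < s" "s < t" for s using fr[OF that(2)] y that J by (meson less_imp_le)
    then show "\<forall>\<^sub>F s in at_left t. s \<in> J" using y unfolding eventually_at_left_field by blast
  qed
  then show "\<exists>u. \<forall>\<^sub>F s in at_left t. ?f s = u"
  proof
    assume "\<forall>\<^sub>F s in at_left t. s \<in> J"
    then have "\<forall>\<^sub>F s in at_left t. ?f s = a" by eventually_elim simp
    then show ?thesis ..
  next
    assume "\<forall>\<^sub>F s in at_left t. s \<notin> J"
    then have "\<forall>\<^sub>F s in at_left t. ?f s = 0" by eventually_elim simp
    then show ?thesis ..
  qed
qed

text \<open>Every clause concerns a bounded range or a neighbourhood of a point. This admits sums
  whose number of terms grows with \<open>t\<close>.\<close>

lemma step_function_local:
  assumes "\<And>b. \<exists>g. step_function g \<and> (\<forall>t. 0 < t \<and> t < b \<longrightarrow> f t = g t)"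
  shows "step_function f"
proof -
  have nhds: "\<forall>\<^sub>F s in nhds t. 0 < s \<and> s < b" if "0 < t" "t < b" for t b :: real
    using eventually_nhds_in_open[of "{0<..<b}" t] that by simp
  show ?thesis
    unfolding step_function_def
  proof (intro conjI allI impI)
    fix b :: real
    obtain g where g: "step_function g" "\<And>t. 0 < t \<Longrightarrow> t < b + 1 \<Longrightarrow> f t = g t" using assms by metis
    then obtain K where "\<And>t. 0 < t \<Longrightarrow> t \<le> b \<Longrightarrow> norm (g t) \<le> K" unfolding step_function_def by metis
    then show "\<exists>K. \<forall>t. 0 < t \<and> t \<le> b \<longrightarrow> norm (f t) \<le> K" using g(2) by (intro exI[of _ K]) auto
    have "{t. 0 < t \<and> t \<le> b \<and> \<not> (\<forall>\<^sub>F s in nhds t. f s = f t)}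
        \<subseteq> {t. 0 < t \<and> t \<le> b \<and> \<not> (\<forall>\<^sub>F s in nhds t. g s = g t)}"
    proof safe
      fix t assume t: "0 < t" "t \<le> b" and n: "\<not> (\<forall>\<^sub>F s in nhds t. f s = f t)" and "\<forall>\<^sub>F s in nhds t. g s = g t"
      then have "\<forall>\<^sub>F s in nhds t. g s = g t \<and> 0 < s \<and> s < b + 1"
        using nhds[of t "b + 1"] by (auto simp: eventually_conj_iff)
      then have "\<forall>\<^sub>F s in nhds t. f s = f t" by eventually_elim (use g(2) t in auto)
      then show False using n by simp
    qed
    then show "finite {t. 0 < t \<and> t \<le> b \<and> \<not> (\<forall>\<^sub>F s in nhds t. f s = f t)}"
      using g(1) unfolding step_function_def by (meson finite_subset)
  next
    fix t :: real assume t: "t > 0"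
    obtain g where g: "step_function g" "\<And>s. 0 < s \<Longrightarrow> s < t + 1 \<Longrightarrow> f s = g s" using assms by metis
    have n: "\<forall>\<^sub>F s in nhds t. 0 < s \<and> s < t + 1" using nhds[of t "t + 1"] t by simp
    then have nr: "\<forall>\<^sub>F s in at_right t. 0 < s \<and> s < t + 1" and nl: "\<forall>\<^sub>F s in at_left t. 0 < s \<and> s < t + 1"
      by (auto simp: eventually_at_filter elim: eventually_mono)
    obtain u where "\<forall>\<^sub>F s in at_right t. g s = u" using g t unfolding step_function_def by metis
    with nr have "\<forall>\<^sub>F s in at_right t. f s = u" by eventually_elim (use g in auto)
    then show "\<exists>u. \<forall>\<^sub>F s in at_right t. f s = u" ..
    obtain v where "\<forall>\<^sub>F s in at_left t. g s = v" using g t unfolding step_function_def by metis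
    with nl have "\<forall>\<^sub>F s in at_left t. f s = v" by eventually_elim (use g in auto)
    then show "\<exists>u. \<forall>\<^sub>F s in at_left t. f s = u" ..
  qed
qed

text \<open>For \<open>t\<close> in \<open>(0, T]\<close> the interpolation formula involves only
  values of \<open>f\<close> on a bounded range and continuous functions on the compact
  \<open>[0, T]\<close>. Periodicity carries the bound to all \<open>t > 0\<close>.\<close>

lemma quasi_poly_coeffs_bounded:
  assumes c: "quasi_poly_coeffs n f c" and f: "step_function f"
  shows "\<exists>K. \<forall>t>0. norm (c r t) \<le> K"
proof -
  obtain T l where T: "T > 0" and per: "\<And>r t. t > 0 \<Longrightarrow> c r (t + T) = c r t"
    and cl: "\<And>r t. t > 0 \<Longrightarrow> c r t = (\<Sum>k\<le>n. f (t + real k * T) * poly.coeff (shift_poly (l k) t) r)"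
    by (rule quasi_poly_coeffs_interpolation[OF c]) blast
  have bl: "\<exists>K\<ge>0. \<forall>t\<in>{0..T}. norm (poly.coeff (shift_poly (l k) t) r) \<le> K" for k
  proof -
    have "continuous_on {0..T} (\<lambda>t. poly.coeff (shift_poly (l k) t) r)"
      by (rule continuous_on_vector_derivative, rule shift_poly_coeff_derivative)
    then have "bounded ((\<lambda>t. poly.coeff (shift_poly (l k) t) r) ` {0..T})"
      by (intro compact_imp_bounded compact_continuous_image) auto
    then show ?thesis unfolding bounded_pos by (metis imageI less_imp_le)
  qed
  then obtain K where K: "\<And>k. K k \<ge> 0" "\<And>k t. t \<in> {0..T} \<Longrightarrow> norm (poly.coeff (shift_poly (l k) t) r) \<le> K k"
    by metis
  obtain M where M: "\<And>t. 0 < t \<Longrightarrow> t \<le> T + real n * T \<Longrightarrow> norm (f t) \<le> M"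
    using f unfolding step_function_def by metis
  have 1: "norm (c r t) \<le> (\<Sum>k\<le>n. M * K k)" if t: "0 < t" "t \<le> T" for t
    unfolding cl[OF t(1)]
  proof (intro order.trans[OF norm_sum] sum_mono)
    fix k assume "k \<in> {..n}"
    then have "t + real k * T \<le> T + real n * T" "0 < t + real k * T"
      using t T by (auto intro: add_mono mult_right_mono add_pos_nonneg)
    then have "norm (f (t + real k * T)) \<le> M" by (intro M)
    then show "norm (f (t + real k * T) * poly.coeff (shift_poly (l k) t) r) \<le> M * K k"
      unfolding norm_mult using K t by (intro mult_mono) (auto intro: order.trans[OF norm_ge_zero])
  qed
  have "norm (c r t) \<le> (\<Sum>k\<le>n. M * K k)" if t: "0 < t" for t
  proof -
    \<comment> \<open>This many periods bring \<open>t\<close> into \<open>(0, T]\<close>.\<close>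
    define j where "j = nat (\<lceil>t / T\<rceil> - 1)"
    have "\<lceil>t / T\<rceil> \<ge> 1" using t T by simp
    then have j: "real j = of_int \<lceil>t / T\<rceil> - 1" by (simp add: j_def)
    have "real j < t / T" "t / T \<le> real j + 1" unfolding j by linarith+
    then have "0 < t - real j * T" "t - real j * T \<le> T" using T by (auto simp: field_simps)
    moreover from this have "c r (t - real j * T + real j * T) = c r (t - real j * T)"
      using per T by (intro periodic_multiple) auto
    ultimately show ?thesis using 1[of "t - real j * T"] by simp
  qed
  then show ?thesis by blast
qed

text \<open>The periods \<open>T\<close> and \<open>U\<close> of \<open>c\<close> and \<open>d\<close> may be incommensurable.  The leading difference \<open>h\<close> tends
  to \<open>0\<close> because all coefficients are bounded; sampling it along multiples of \<open>U\<close> shows that \<open>d\<close>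
  has period \<open>T\<close> as well, and then \<open>h\<close> is periodic and tends to \<open>0\<close>.  Without boundedness
  uniqueness fails: consider an additive \<open>f\<close>.\<close>

lemma quasi_poly_coeffs_unique:
  assumes c: "quasi_poly_coeffs n f c" and d: "quasi_poly_coeffs n f d" and f: "step_function f"
    and "r \<le> n" "t > 0"
  shows "c r t = d r t"
  using assms(4,5)
proof (induction "n - r" arbitrary: r t rule: less_induct)
  case less
  have higher: "c s t = d s t" if "r < s" "s \<le> n" "t > 0" for s t
    using less.hyps[of s t] that by simp
  obtain T where T: "T > 0" "\<forall>t>0. c r (t + T) = c r t"
    by (rule quasi_poly_coeffs_interpolation[OF c]) blast
  obtain U where U: "U > 0" "\<forall>t>0. d r (t + U) = d r t"
    by (rule quasi_poly_coeffs_interpolation[OF d]) blast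
  obtain K where K: "\<And>s t. t > 0 \<Longrightarrow> norm (c s t) \<le> K s"
    using quasi_poly_coeffs_bounded[OF c f] by metis
  obtain L where L: "\<And>s t. t > 0 \<Longrightarrow> norm (d s t) \<le> L s"
    using quasi_poly_coeffs_bounded[OF d f] by metis
  define h where "h t = c r t - d r t" for t
  define M where "M = (\<Sum>s<r. K s + L s)"
  \<comment> \<open>The higher coefficients agree by induction, so equality of the two expansions
    balances the term of degree \<open>r\<close> against lower ones, which grow at most like
    \<open>t ^ (r - 1)\<close>.\<close>
  have h: "norm (h t) \<le> M / t" if t: "t \<ge> 1" for t
  proof -
    have "(\<Sum>s\<le>n. c s t * of_real t ^ s) = (\<Sum>s\<le>n. d s t * of_real t ^ s)"
      using c d t by (auto simp: quasi_poly_coeffs_def)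
    then have "0 = (\<Sum>s\<le>n. (c s t - d s t) * of_real t ^ s)"
      by (simp add: sum_subtractf left_diff_distrib)
    also have "\<dots> = (\<Sum>s\<le>r. (c s t - d s t) * of_real t ^ s)"
      using less.prems higher t by (intro sum.mono_neutral_right) auto
    also have "\<dots> = h t * of_real t ^ r + (\<Sum>s<r. (c s t - d s t) * of_real t ^ s)"
      by (simp add: lessThan_Suc_atMost[symmetric] h_def)
    finally have eq: "h t * of_real t ^ r = - (\<Sum>s<r. (c s t - d s t) * of_real t ^ s)"
      by (simp add: eq_neg_iff_add_eq_0)
    have "norm (h t) * t ^ r = norm (h t * of_real t ^ r)"
      using t by (simp add: norm_mult norm_power)
    also have "\<dots> = norm (\<Sum>s<r. (c s t - d s t) * of_real t ^ s)"
      unfolding eq by simp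
    also have "\<dots> \<le> (\<Sum>s<r. (K s + L s) * t ^ (r - 1))"
    proof (intro order.trans[OF norm_sum] sum_mono)
      fix s assume s: "s \<in> {..<r}"
      have "norm (c s t - d s t) \<le> K s + L s"
        using K[of t s] L[of t s] t by (intro order.trans[OF norm_triangle_ineq4]) auto
      moreover have "norm (of_real t ^ s :: complex) \<le> t ^ (r - 1)"
        using s t by (simp add: norm_power power_increasing)
      ultimately show "norm ((c s t - d s t) * of_real t ^ s) \<le> (K s + L s) * t ^ (r - 1)"
        unfolding norm_mult by (intro mult_mono) (auto intro: order.trans[OF norm_ge_zero])
    qed
    also have "\<dots> = M * t ^ (r - 1)" by (simp add: M_def sum_distrib_right)
    finally have *: "norm (h t) * t ^ r \<le> M * t ^ (r - 1)" .
    have "norm (h t) * t \<le> M"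
    proof (cases r)
      \<comment> \<open>Without lower terms \<open>M\<close> is 0, so the truncated exponent
        \<open>r - 1\<close> does no harm.\<close>
      case 0
      then have "norm (h t) \<le> 0" using * by (simp add: M_def)
      then show ?thesis using 0 by (simp add: M_def)
    next
      case (Suc r')
      then have "(norm (h t) * t) * t ^ r' \<le> M * t ^ r'" using * by (simp add: mult_ac)
      then show ?thesis using t by (simp add: mult_le_cancel_right)
    qed
    then show ?thesis using t by (simp add: field_simps)
  qed
  have lim: "(\<lambda>j. h (t + real j * V)) \<longlonglongrightarrow> 0" if "V > 0" for t V
  proof (rule Lim_null_comparison)
    have top: "filterlim (\<lambda>j. t + real j * V) at_top sequentially"
      using that by (intro filterlim_tendsto_add_at_top[OF tendsto_const]
          filterlim_at_top_mult_tendsto_pos[OF tendsto_const _ filterlim_real_sequentially])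
    then have "\<forall>\<^sub>F j in sequentially. t + real j * V \<ge> 1" by (simp add: filterlim_at_top)
    then show "\<forall>\<^sub>F j in sequentially. norm (h (t + real j * V)) \<le> M / (t + real j * V)"
      by eventually_elim (rule h)
    show "(\<lambda>j. M / (t + real j * V)) \<longlonglongrightarrow> 0"
      using top by (intro tendsto_divide_0[OF tendsto_const] filterlim_at_top_imp_at_infinity)
  qed
  have dT: "d r (t + T) = d r t" if t: "t > 0" for t
  proof -
    have "h (t + T + real j * U) - h (t + real j * U) = d r t - d r (t + T)" for j
    proof -
      have "d r (t + T + real j * U) = d r (t + T)" "d r (t + real j * U) = d r t"
        using U T(1) t by (auto intro!: periodic_multiple)
      moreover have "c r (t + real j * U + T) = c r (t + real j * U)"
        using t U(1) by (intro T(2)[rule_format] add_pos_nonneg) auto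
      ultimately show ?thesis by (simp add: h_def add_ac)
    qed
    then have "(\<lambda>j. d r t - d r (t + T)) \<longlonglongrightarrow> 0 - 0"
      using tendsto_diff[OF lim[OF U(1), of "t + T"] lim[OF U(1), of t]] by simp
    then show ?thesis by (simp add: LIMSEQ_const_iff)
  qed
  have "h (t + real j * T) = h t" for j
    using periodic_multiple[of "d r" T t j] periodic_multiple[of "c r" T t j] dT T less.prems
    by (simp add: h_def)
  then have "(\<lambda>j. h t) \<longlonglongrightarrow> 0" using lim[OF T(1), of t] by simp
  then show ?case by (simp add: LIMSEQ_const_iff h_def)
qed

text \<open>The models \<open>A\<close> on the right and \<open>B\<close> on the left may differ,
  but they share value and derivative at \<open>t\<close>, so the remainder quotient of
  \<open>f\<close> tends to 0 from both sides.\<close>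

lemma has_vector_derivative_one_sided:
  fixes f :: "real \<Rightarrow> 'a::real_normed_vector"
  assumes "(A has_vector_derivative D) (at t)" "(B has_vector_derivative D) (at t)"
    and "A t = f t" "B t = f t" "\<forall>\<^sub>F s in at_right t. f s = A s" "\<forall>\<^sub>F s in at_left t. f s = B s"
  shows "(f has_vector_derivative D) (at t)"
proof -
  let ?q = "\<lambda>g y. (1 / norm (y - t)) *\<^sub>R (g y - (g t + (y - t) *\<^sub>R D))"
  have lim: "(?q g \<longlongrightarrow> 0) (at t)" if "(g has_vector_derivative D) (at t)" for g
    using that unfolding has_vector_derivative_def has_derivative_within by auto
  have "(?q A \<longlongrightarrow> 0) (at_right t)" "(?q B \<longlongrightarrow> 0) (at_left t)"
    using lim[OF assms(1)] lim[OF assms(2)] by (simp_all add: filterlim_at_split)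
  moreover have "\<forall>\<^sub>F y in at_right t. ?q A y = ?q f y" "\<forall>\<^sub>F y in at_left t. ?q B y = ?q f y"
    using assms(3-6) by (auto elim!: eventually_mono)
  ultimately have "(?q f \<longlongrightarrow> 0) (at_right t)" "(?q f \<longlongrightarrow> 0) (at_left t)"
    by (auto intro: Lim_transform_eventually)
  then have "(?q f \<longlongrightarrow> 0) (at t)" by (rule filterlim_split_at[rotated])
  then show ?thesis
    unfolding has_vector_derivative_def has_derivative_within
    by (auto intro: bounded_linear_scaleR_left)
qed

text \<open>By the interpolation formula all coefficients are continuous at \<open>t\<close> unless
  \<open>f\<close> fails to be locally constant at some \<open>t + k T\<close> with
  \<open>k \<le> n\<close>; a bounded range contains finitely many such points.\<close>

lemma quasi_poly_coeffs_finite_discontinuities: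
  assumes c: "quasi_poly_coeffs n f c" and f: "step_function f"
  shows "finite {t. 0 < t \<and> t \<le> b \<and> (\<exists>r. \<not> isCont (c r) t)}"
proof -
  obtain T l where T: "T > 0"
    and cl: "\<And>r t. t > 0 \<Longrightarrow> c r t = (\<Sum>k\<le>n. f (t + real k * T) * poly.coeff (shift_poly (l k) t) r)"
    by (rule quasi_poly_coeffs_interpolation[OF c]) blast
  define X where "X k = {t. 0 < t \<and> t \<le> b + real k * T \<and> \<not> (\<forall>\<^sub>F s in nhds t. f s = f t)}" for k :: nat
  have "{t. 0 < t \<and> t \<le> b \<and> (\<exists>r. \<not> isCont (c r) t)} \<subseteq> (\<Union>k\<le>n. (\<lambda>s. s - real k * T) ` X k)"
  proof safe
    fix t r assume t: "0 < t" "t \<le> b" and disc: "\<not> isCont (c r) t"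
    have "\<exists>k\<le>n. t + real k * T \<in> X k"
    proof (rule ccontr)
      assume no: "\<not> (\<exists>k\<le>n. t + real k * T \<in> X k)"
      have "\<forall>\<^sub>F s in nhds t. f (s + real k * T) = f (t + real k * T)" if "k \<le> n" for k
      proof -
        have "0 < t + real k * T" using t T by (intro add_pos_nonneg) auto
        then have "\<forall>\<^sub>F s in nhds (t + real k * T). f s = f (t + real k * T)"
          using no that t by (auto simp: X_def)
        moreover have "filterlim (\<lambda>s. s + real k * T) (nhds (t + real k * T)) (nhds t)"
          by (intro tendsto_intros filterlim_ident)
        ultimately show ?thesis by (rule eventually_compose_filterlim)
      qed
      then have "\<forall>\<^sub>F s in nhds t. \<forall>k\<in>{..n}. f (s + real k * T) = f (t + real k * T)"
        by (intro eventually_ball_finite) auto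
      moreover have "\<forall>\<^sub>F s in nhds t. s \<in> {0<..}" using t by (intro eventually_nhds_in_open) auto
      ultimately have "\<forall>\<^sub>F s in nhds t. c r s = (\<Sum>k\<le>n. f (t + real k * T) * poly.coeff (shift_poly (l k) s) r)"
        by eventually_elim (auto simp: cl intro!: sum.cong)
      moreover have "isCont (\<lambda>s. \<Sum>k\<le>n. f (t + real k * T) * poly.coeff (shift_poly (l k) s) r) t"
        by (intro continuous_intros has_vector_derivative_continuous[OF shift_poly_coeff_derivative])
      ultimately have "isCont (c r) t" by (simp only: isCont_cong)
      then show False using disc by simp
    qed
    then obtain k where "k \<le> n" "t + real k * T \<in> X k" by auto
    then show "t \<in> (\<Union>k\<le>n. (\<lambda>s. s - real k * T) ` X k)"
      by (intro UN_I[of k] image_eqI[of _ _ "t + real k * T"]) auto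
  qed
  moreover have "finite (X k)" for k using f unfolding X_def step_function_def by blast
  ultimately show ?thesis by (elim finite_subset) auto
qed

text \<open>On either side of \<open>t\<close> the samples \<open>f (s + k T)\<close> are constant,
  so the coefficients there are those of a fixed polynomial being shifted, which satisfy the
  equation. Continuity of the two consecutive coefficients makes both models agree with them at
  \<open>t\<close>, hence share the derivative.\<close>

lemma quasi_poly_coeffs_derivative:
  assumes c: "quasi_poly_coeffs n f c" and f: "step_function f"
    and t: "t > 0" and cont: "isCont (c r) t" "isCont (c (Suc r)) t"
  shows "(c r has_vector_derivative - (of_nat (r + 1) * c (r + 1) t)) (at t)"
proof -
  obtain T l where T: "T > 0"
    and cl: "\<And>r t. t > 0 \<Longrightarrow> c r t = (\<Sum>k\<le>n. f (t + real k * T) * poly.coeff (shift_poly (l k) t) r)"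
    by (rule quasi_poly_coeffs_interpolation[OF c]) blast
  define A where "A u r s = (\<Sum>k\<le>n. u k * poly.coeff (shift_poly (l k) s) r)" for u r s
  have der: "(A u r has_vector_derivative - (of_nat (r + 1) * A u (r + 1) s)) (at s)" for u r s
  proof -
    have "(A u r has_vector_derivative (\<Sum>k\<le>n. u k * - (of_nat (r + 1) * poly.coeff (shift_poly (l k) s) (r + 1)))) (at s)"
      unfolding A_def
      by (intro has_vector_derivative_sum has_vector_derivative_mult_right shift_poly_coeff_derivative)
    moreover have "(\<Sum>k\<le>n. u k * - (of_nat (r + 1) * poly.coeff (shift_poly (l k) s) (r + 1)))
        = - (of_nat (r + 1) * A u (r + 1) s)"
      unfolding A_def sum_distrib_left sum_negf[symmetric] by (intro sum.cong) (simp_all add: algebra_simps)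
    ultimately show ?thesis by simp
  qed
  have side: "\<exists>u. (\<forall>r. \<forall>\<^sub>F s in F. c r s = A u r s)"
    if F: "F = at_right t \<or> F = at_left t" for F
  proof -
    have "\<exists>v. \<forall>\<^sub>F s in F. f (s + a) = v" if "a \<ge> 0" for a
    proof -
      have "t + a > 0" using t that by simp
      then obtain v v' where v: "\<forall>\<^sub>F s in at_right (t + a). f s = v" "\<forall>\<^sub>F s in at_left (t + a). f s = v'"
        using f unfolding step_function_def by metis
      have "\<forall>\<^sub>F s in at_right t. f (s + a) = v"
      proof -
        obtain y where "y > t + a" "\<And>s. s > t + a \<Longrightarrow> s < y \<Longrightarrow> f s = v"
          using v(1) unfolding eventually_at_right_field by auto
        then show ?thesis unfolding eventually_at_right_field by (intro exI[of _ "y - a"]) auto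
      qed
      moreover have "\<forall>\<^sub>F s in at_left t. f (s + a) = v'"
      proof -
        obtain y where "y < t + a" "\<And>s. s < t + a \<Longrightarrow> s > y \<Longrightarrow> f s = v'"
          using v(2) unfolding eventually_at_left_field by auto
        then show ?thesis unfolding eventually_at_left_field by (intro exI[of _ "y - a"]) auto
      qed
      ultimately show ?thesis using F by auto
    qed
    then have "\<exists>v. \<forall>\<^sub>F s in F. f (s + real k * T) = v" for k using T by simp
    then obtain u where "\<And>k. \<forall>\<^sub>F s in F. f (s + real k * T) = u k" by metis
    then have "\<forall>\<^sub>F s in F. \<forall>k\<in>{..n}. f (s + real k * T) = u k"
      by (intro eventually_ball_finite) auto
    moreover have "\<forall>\<^sub>F s in nhds t. s \<in> {0<..}" using t by (intro eventually_nhds_in_open) auto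
    then have "\<forall>\<^sub>F s in F. s > 0" using F by (auto simp: eventually_at_filter elim: eventually_mono)
    ultimately have "\<forall>\<^sub>F s in F. c r s = A u r s" for r
      by eventually_elim (auto simp: cl A_def intro!: sum.cong)
    then show ?thesis by blast
  qed
  obtain u where u: "\<And>r. \<forall>\<^sub>F s in at_right t. c r s = A u r s" using side by blast
  obtain v where v: "\<And>r. \<forall>\<^sub>F s in at_left t. c r s = A v r s" using side by blast
  have eq: "c i t = A u' i t"
    if "isCont (c i) t" "\<forall>\<^sub>F s in F. c i s = A u' i s" "F = at_right t \<or> F = at_left t" for i u' F
  proof -
    have "isCont (A u' i) t" using has_vector_derivative_continuous[OF der] by simp
    then have "(A u' i \<longlongrightarrow> A u' i t) F"
      using that(3) by (auto simp: isCont_def filterlim_at_split)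
    moreover have "(c i \<longlongrightarrow> c i t) F" using that(1,3) by (auto simp: isCont_def filterlim_at_split)
    then have "(A u' i \<longlongrightarrow> c i t) F" using that(2) by (rule Lim_transform_eventually)
    moreover have "F \<noteq> bot"
      using that(3) by (elim disjE) simp_all
    ultimately show ?thesis by (intro tendsto_unique[of F "A u' i"])
  qed
  have eqs: "A u r t = c r t" "A v r t = c r t" "A u (r + 1) t = c (r + 1) t" "A v (r + 1) t = c (r + 1) t"
    using eq[where i=r and F="at_right t" and u'=u] eq[where i=r and F="at_left t" and u'=v] eq[where i="r + 1" and F="at_right t" and u'=u]
      eq[where i="r + 1" and F="at_left t" and u'=v] u v cont by simp_all
  show ?thesis
  proof (rule has_vector_derivative_one_sided)
    show "(A u r has_vector_derivative - (of_nat (r + 1) * c (r + 1) t)) (at t)"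
      using der[of u r t] unfolding eqs .
    show "(A v r has_vector_derivative - (of_nat (r + 1) * c (r + 1) t)) (at t)"
      using der[of v r t] unfolding eqs .
  qed (fact eqs u v)+
qed

section \<open>The power sum as a step function of the dilation factor\<close>

context numbered_polytope
begin

text \<open>If \<open>p / t1\<close> and \<open>p / t2\<close> lie in \<open>P\<close> and
  \<open>t = u t1 + v t2\<close>, then \<open>p / t\<close> is their convex combination with weights
  \<open>u t1 / t\<close> and \<open>v t2 / t\<close>. So a lattice point is present for an interval
  of dilation factors, even if \<open>P\<close> misses the origin.\<close>

lemma convex_dilation_parameters: "convex {t. 0 < t \<and> p \<in> (\<lambda>x. t *\<^sub>R x) ` P}"
proof (rule convexI)
  fix t1 t2 u v :: real
  assume t1: "t1 \<in> {t. 0 < t \<and> p \<in> (\<lambda>x. t *\<^sub>R x) ` P}" and t2: "t2 \<in> {t. 0 < t \<and> p \<in> (\<lambda>x. t *\<^sub>R x) ` P}"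
    and uv: "0 \<le> u" "0 \<le> v" "u + v = 1"
  from t1 obtain x1 where x1: "x1 \<in> P" "p = t1 *\<^sub>R x1" "t1 > 0" by auto
  from t2 obtain x2 where x2: "x2 \<in> P" "p = t2 *\<^sub>R x2" "t2 > 0" by auto
  define t where "t = u * t1 + v * t2"
  have t: "t > 0" unfolding t_def using uv x1(3) x2(3)
    by (metis add_0 add_nonneg_pos add_pos_nonneg less_eq_real_def mult_eq_0_iff mult_pos_pos zero_neq_one)
  have "(u * t1 / t) *\<^sub>R x1 + (v * t2 / t) *\<^sub>R x2 \<in> P"
    using convex_P x1(1,3) x2(1,3) uv t
    by (intro convexD) (auto simp: add_divide_distrib[symmetric] t_def)
  moreover have "t *\<^sub>R ((u * t1 / t) *\<^sub>R x1 + (v * t2 / t) *\<^sub>R x2) = u *\<^sub>R (t1 *\<^sub>R x1) + v *\<^sub>R (t2 *\<^sub>R x2)"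
    using t by (simp add: scaleR_add_right)
  then have "p = t *\<^sub>R ((u * t1 / t) *\<^sub>R x1 + (v * t2 / t) *\<^sub>R x2)"
    unfolding x1(2)[symmetric] x2(2)[symmetric] using uv(3) by (simp add: scaleR_add_left[symmetric])
  ultimately show "u *\<^sub>R t1 + v *\<^sub>R t2 \<in> {t. 0 < t \<and> p \<in> (\<lambda>x. t *\<^sub>R x) ` P}"
    using t by (auto simp: t_def)
qed

text \<open>For \<open>t < b\<close> all dilates lie in a ball of radius \<open>b * B\<close>, so
  finitely many lattice points matter, each contributing a constant times an interval
  indicator.\<close>

lemma step_function_power_sum: "step_function (power_sum P m z)"
proof (rule step_function_local)
  fix b :: real
  obtain B where B: "\<And>x. x \<in> P \<Longrightarrow> norm x \<le> B" "B > 0"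
    using polytope_imp_bounded[OF polytope] by (auto simp: bounded_pos)
  define A where "A = cball 0 (b * B) \<inter> (int_lattice :: (real^'n) set)"
  have finA: "finite A" unfolding A_def by (intro finite_bounded_int_lattice) auto
  let ?J = "\<lambda>p. {t. 0 < t \<and> p \<in> (\<lambda>x. t *\<^sub>R x) ` P}"
  have "power_sum P m z t = (\<Sum>p\<in>A. of_bool (t \<in> ?J p) * pairing p z ^ m)" if t: "0 < t" "t < b" for t
  proof -
    have "(\<lambda>x. t *\<^sub>R x) ` P \<inter> int_lattice \<subseteq> A"
      using B t by (auto simp: A_def intro!: mult_mono)
    then have "power_sum P m z t = (\<Sum>p\<in>A. if p \<in> (\<lambda>x. t *\<^sub>R x) ` P \<inter> int_lattice then pairing p z ^ m else 0)"
      unfolding power_sum_def using finA by (simp only: sum.inter_restrict[symmetric] Int_absorb1)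
    also have "\<dots> = (\<Sum>p\<in>A. of_bool (t \<in> ?J p) * pairing p z ^ m)"
      using t(1) by (intro sum.cong) (auto simp: A_def)
    finally show ?thesis .
  qed
  moreover have "step_function (\<lambda>t. \<Sum>p\<in>A. of_bool (t \<in> ?J p) * pairing p z ^ m)"
    by (intro step_function_sum step_function_interval convex_dilation_parameters)
  ultimately show "\<exists>g. step_function g \<and> (\<forall>t. 0 < t \<and> t < b \<longrightarrow> power_sum P m z t = g t)" by blast
qed

end

theorem theorem2:
  fixes P :: "(real^'n) set"
    and w :: "real^'n \<Rightarrow> 'n \<Rightarrow> real^'n"
    and m :: nat
  assumes "rational_polytope P"
    and "aff_dim P = int CARD('n)"
    and "simple_polytope P"
    and "edge_numbering P w"
    and "m > 0"
  shows
    "(\<forall>z. generic P w z \<longrightarrow> (\<forall>t>0.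
        power_sum P m z t =
          (-1) ^ CARD('n) * fact m *
          (\<Sum>v\<in>vertices P. \<Sum>k\<le>CARD('n) + m.
             1 / (fact k * fact (CARD('n) + m - k))
             * barnes_poly k (of_real t * pairing v z) (edge_values (w v) z)
             * (\<Sum>q\<in>box_points (w v) t v. pairing q z ^ (CARD('n) + m - k)))))
   \<and> (\<forall>z. generic P w z \<longrightarrow>
        (\<exists>c. quasi_poly_coeffs (CARD('n) + m) (power_sum P m z) c) \<and>
        (\<forall>c. quasi_poly_coeffs (CARD('n) + m) (power_sum P m z) c \<longrightarrow>
          (\<forall>r\<le>CARD('n) + m. \<forall>t>0.
             c r t =
               (-1) ^ CARD('n) * fact m / fact (CARD('n) + m) *
               (\<Sum>v\<in>vertices P. \<Sum>j\<le>CARD('n) + m - r.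
                  trinomial (CARD('n) + m) r j
                  * barnes_number j (edge_values (w v) z)
                  * pairing v z ^ r
                  * (\<Sum>q\<in>box_points (w v) t v. pairing q z ^ (CARD('n) + m - r - j))))))
   \<and> (\<forall>z c. generic P w z \<longrightarrow> quasi_poly_coeffs (CARD('n) + m) (power_sum P m z) c \<longrightarrow>
        (\<forall>b. finite {t. 0 < t \<and> t \<le> b \<and> (\<exists>r. \<not> isCont (c r) t)}) \<and>
        (\<forall>r. \<forall>t>0. isCont (c r) t \<longrightarrow> isCont (c (Suc r)) t \<longrightarrow>
          (c r has_vector_derivative - (of_nat (r + 1) * c (r + 1) t)) (at t)))"
proof -
  interpret numbered_polytope P w
    using assms(1,2,4) by unfold_locales
  show ?thesis
  proof (intro conjI allI impI)
    fix z t assume "generic P w z" "(t::real) > 0"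
    then show "power_sum P m z t =
          (-1) ^ CARD('n) * fact m *
          (\<Sum>v\<in>vertices P. \<Sum>k\<le>CARD('n) + m.
             1 / (fact k * fact (CARD('n) + m - k))
             * barnes_poly k (of_real t * pairing v z) (edge_values (w v) z)
             * (\<Sum>q\<in>box_points (w v) t v. pairing q z ^ (CARD('n) + m - k)))"
      by (intro power_sum_formula)
  next
    fix z assume z: "generic P w z"
    show "\<exists>c. quasi_poly_coeffs (CARD('n) + m) (power_sum P m z) c"
      using quasi_poly_coeffs_exist[OF z] by blast
    fix c r and t :: real
    assume c: "quasi_poly_coeffs (CARD('n) + m) (power_sum P m z) c"
      and r: "r \<le> CARD('n) + m" and t: "t > 0"
    \<comment> \<open>The explicit coefficients form one admissible family, and uniqueness
      identifies \<open>c\<close> with it.\<close>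
    show "c r t = (-1) ^ CARD('n) * fact m / fact (CARD('n) + m) *
               (\<Sum>v\<in>vertices P. \<Sum>j\<le>CARD('n) + m - r.
                  trinomial (CARD('n) + m) r j
                  * barnes_number j (edge_values (w v) z)
                  * pairing v z ^ r
                  * (\<Sum>q\<in>box_points (w v) t v. pairing q z ^ (CARD('n) + m - r - j)))"
      using quasi_poly_coeffs_unique[OF c quasi_poly_coeffs_exist[OF z] step_function_power_sum r t] r
      by (simp only: if_True quasi_coeff_def)
  next
    fix z c b assume "quasi_poly_coeffs (CARD('n) + m) (power_sum P m z) c"
    then show "finite {t. 0 < t \<and> t \<le> b \<and> (\<exists>r. \<not> isCont (c r) t)}"
      using step_function_power_sum by (rule quasi_poly_coeffs_finite_discontinuities)
  next
    fix z c r and t :: real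
    assume "quasi_poly_coeffs (CARD('n) + m) (power_sum P m z) c"
      "0 < t" "isCont (c r) t" "isCont (c (Suc r)) t"
    then show "(c r has_vector_derivative - (of_nat (r + 1) * c (r + 1) t)) (at t)"
      using step_function_power_sum quasi_poly_coeffs_derivative by blast
  qed
qed

end
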